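(* Let $\mathcal{C}$ be a compactly accessible category (with respect to a compactly presentable weak factorisation system $(E,M)$), and suppose a chosen dual $(X^*,\eta_X,\varepsilon_X)$ has been fixed for every compact object $X$. Then there is a functor $(-)^*:\mathcal{C}^{\mathrm{op}}\to\mathcal{C}$ with the following properties: for every object $X$, $X^*$ is a limit of the dual diagram $D^*$ for some directed diagram $D$ of compactly presentable objects with $\mathrm{colim}(D)\cong X$; the action on a morphism $f:X\to Y$ is the morphism $f^*:Y^*\to X^*$ given by the dual-morphism construction described in the context; and the restriction of $(-)^*$ to the full subcategory $\mathcal{C}_{\mathrm{cpt}}$ of compact objects coincides with the choice-of-duals functor on $\mathcal{C}_{\mathrm{cpt}}$ (on objects it returns the chosen duals, and on morphisms between compact objects it returns the morphism $f^*$ defined below for compact objects).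
   Context: Let $\mathcal{C}$ be a symmetric monoidal category with unit $I$. An object $X$ is compact if there are an object $Y$ and morphisms $\eta:I\to Y\otimes X$, $\varepsilon:X\otimes Y\to I$ satisfying the triangle identities: $X\cong X\otimes I\xrightarrow{\mathrm{id}\otimes\eta}X\otimes(Y\otimes X)\cong(X\otimes Y)\otimes X\xrightarrow{\varepsilon\otimes\mathrm{id}}I\otimes X\cong X$ is the identity, and $Y\cong I\otimes Y\xrightarrow{\eta\otimes\mathrm{id}}(Y\otimes X)\otimes Y\cong Y\otimes(X\otimes Y)\xrightarrow{\mathrm{id}\otimes\varepsilon}Y\otimes I\cong Y$ is the identity. A chosen such $Y$ is written $X^*$ (with $\eta_X,\varepsilon_X$). $\mathcal{C}_{\mathrm{cpt}}$ is the full subcategory of compact objects. For $f:X\to Y$ between compact objects, $f^*:Y^*\to X^*$ is the composite $Y^*\cong Y^*\otimes I\to Y^*\otimes(X\otimes X^* )\to (Y^*\otimes Y)\otimes X^*\to I\otimes X^*\cong X^*$ of $\mathrm{id}\otimes\eta_X$, $\mathrm{id}\otimes f\otimes\mathrm{id}$, $\varepsilon_Y\otimes\mathrm{id}$ (composing $\eta_X,\varepsilon_Y$ with symmetry isomorphisms as needed); this gives a functor $\mathcal{C}_{\mathrm{cpt}}^{\mathrm{op}}\to\mathcal{C}_{\mathrm{cpt}}$. For a diagram $D:\mathcal{J}\to\mathcal{C}$ landing in compact objects, its dual diagram is $D^*=(-)^*\circ D:\mathcal{J}^{\mathrm{op}}\to\mathcal{C}$. A weak factorisation system $(E,M)$ consists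 of two classes of morphisms, each containing all isomorphisms and closed under composition, such that every morphism factors as $m\circ e$ with $e\in E$, $m\in M$, and whenever $v\circ m\circ e=m'\circ e'\circ u$ with $e,e'\in E$, $m,m'\in M$, there is $w$ with $w\circ e=e'\circ u$ and $m'\circ w=v\circ m$. A compact object $X$ is compactly presentable (w.r.t. $(E,M)$) if for every directed diagram $D:\mathcal{J}\to\mathcal{C}$ of compact objects with colimit cocone $d_j:D(j)\to Y$ and every $m:X\to Y$ in $M$ there are $j$ and $n:X\to D(j)$ in $M$ with $m=d_j\circ n$, and if $d_j\circ n=d_j\circ n'$ then $D(j\to j')\circ n=D(j\to j')\circ n'$ for some $j'$. The weak factorisation system is compactly presentable if whenever $X\to Y$ is in $E$ and $X$ is compactly presentable, $Y$ is compactly presentable. $\mathcal{C}$ is compactly accessible if it is symmetric monoidal, has colimits of directed diagrams of compact objects and limits of codirected diagrams of compact objects, is equipped with a compactly presentable weak factorisation system, and has a set $A$ of compactly presentable objects such that every object is a directed colimit of objects of $A$. Dual-morphism construction: given $f:X\to Y$, pick directed diagrams $C:\mathcal{I}\to\mathcal{C}$, $D:\mathcal{J}\to\mathcal{C}$ of compactly presentable objects with colimit cocones $c_i:C(i)\to X$, $d_j:D(j)\to Y$, and limit cones $c_i^*:X^*\to C^*(i)$, $d_j^*:Y^*\to D^*(j)$. Factor $f\circ c_i=m_i\circ f_i$ with $f_i:C(i)\to X_i$ in $E$, $m_i\in M$; as $X_i$ is compactly presentable there are $j_i$ and $n_i:X_i\to D(j_i)$ in $M$ with $m_i=d_{j_i}\circ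 n_i$. The morphisms $f_i^*\circ n_i^*\circ d_{j_i}^*:Y^*\to C^*(i)$ form a cone over $C^*$, and $f^*:Y^*\to X^*$ is the unique mediating morphism. *)

theory Defs
  imports Main "HOL-Library.Equipollence"
begin

section \<open>Categories, functors, limits and colimits\<close>

record ('o, 'm) cat =
  Obj :: "'o set"
  Arr :: "'m set"
  Dom :: "'m \<Rightarrow> 'o"
  Cod :: "'m \<Rightarrow> 'o"
  Ident :: "'o \<Rightarrow> 'm"
  Comp :: "'m \<Rightarrow> 'm \<Rightarrow> 'm"  (infixr \<open>\<cdot>\<index>\<close> 70)

definition Hom :: "('o, 'm, 'x) cat_scheme \<Rightarrow> 'o \<Rightarrow> 'o \<Rightarrow> 'm set" where
  "Hom C X Y = {f \<in> Arr C. Dom C f = X \<and> Cod C f = Y}"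

locale category =
  fixes C :: "('o, 'm, 'x) cat_scheme"  (structure)
  assumes dom_closed: "f \<in> Arr C \<Longrightarrow> Dom C f \<in> Obj C"
    and cod_closed: "f \<in> Arr C \<Longrightarrow> Cod C f \<in> Obj C"
    and ident_hom: "X \<in> Obj C \<Longrightarrow> Ident C X \<in> Hom C X X"
    and comp_hom: "f \<in> Hom C X Y \<Longrightarrow> g \<in> Hom C Y Z \<Longrightarrow> g \<cdot> f \<in> Hom C X Z"
    and comp_assoc: "f \<in> Hom C W X \<Longrightarrow> g \<in> Hom C X Y \<Longrightarrow> h \<in> Hom C Y Z \<Longrightarrow>
      (h \<cdot> g) \<cdot> f = h \<cdot> (g \<cdot> f)"
    and ident_left: "f \<in> Hom C X Y \<Longrightarrow> Ident C Y \<cdot> f = f"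
    and ident_right: "f \<in> Hom C X Y \<Longrightarrow> f \<cdot> Ident C X = f"

definition inverse_arrows :: "('o, 'm, 'x) cat_scheme \<Rightarrow> 'm \<Rightarrow> 'm \<Rightarrow> bool" where
  "inverse_arrows C f g \<longleftrightarrow> f \<in> Arr C \<and> g \<in> Hom C (Cod C f) (Dom C f) \<and>
     g \<cdot>\<^bsub>C\<^esub> f = Ident C (Dom C f) \<and> f \<cdot>\<^bsub>C\<^esub> g = Ident C (Cod C f)"

definition iso :: "('o, 'm, 'x) cat_scheme \<Rightarrow> 'm \<Rightarrow> bool" where
  "iso C f \<longleftrightarrow> (\<exists>g. inverse_arrows C f g)"

definition Inv :: "('o, 'm, 'x) cat_scheme \<Rightarrow> 'm \<Rightarrow> 'm" where
  "Inv C f = (THE g. inverse_arrows C f g)"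

definition op_cat :: "('o, 'm, 'x) cat_scheme \<Rightarrow> ('o, 'm) cat" where
  "op_cat C = \<lparr>Obj = Obj C, Arr = Arr C, Dom = Cod C, Cod = Dom C, Ident = Ident C,
     Comp = (\<lambda>g f. f \<cdot>\<^bsub>C\<^esub> g)\<rparr>"

text \<open>A poset as a category: the pair \<open>(i, j)\<close> with \<open>i \<le> j\<close> is the unique arrow from
  \<open>i\<close> to \<open>j\<close>.\<close>

definition poset_cat :: "'u set \<Rightarrow> 'u rel \<Rightarrow> ('u, 'u \<times> 'u) cat" where
  "poset_cat J r = \<lparr>Obj = J, Arr = r, Dom = fst, Cod = snd, Ident = (\<lambda>j. (j, j)),
     Comp = (\<lambda>b a. (fst a, snd b))\<rparr>"

record ('a, 'k, 'o, 'm) cfunctor =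
  FObj :: "'a \<Rightarrow> 'o"
  FArr :: "'k \<Rightarrow> 'm"

definition is_functor ::
    "('a, 'k, 'x) cat_scheme \<Rightarrow> ('o, 'm, 'y) cat_scheme \<Rightarrow> ('a, 'k, 'o, 'm) cfunctor \<Rightarrow> bool" where
  "is_functor A B F \<longleftrightarrow> category A \<and> category B \<and>
     (\<forall>X\<in>Obj A. FObj F X \<in> Obj B) \<and>
     (\<forall>X Y. \<forall>f\<in>Hom A X Y. FArr F f \<in> Hom B (FObj F X) (FObj F Y)) \<and>
     (\<forall>X\<in>Obj A. FArr F (Ident A X) = Ident B (FObj F X)) \<and>
     (\<forall>X Y Z. \<forall>f\<in>Hom A X Y. \<forall>g\<in>Hom A Y Z.
        FArr F (g \<cdot>\<^bsub>A\<^esub> f) = FArr F g \<cdot>\<^bsub>B\<^esub> FArr F f)"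

definition cocone :: "('a, 'k, 'x) cat_scheme \<Rightarrow> ('o, 'm, 'y) cat_scheme \<Rightarrow>
    ('a, 'k, 'o, 'm) cfunctor \<Rightarrow> 'o \<Rightarrow> ('a \<Rightarrow> 'm) \<Rightarrow> bool" where
  "cocone J C D Y d \<longleftrightarrow> Y \<in> Obj C \<and>
     (\<forall>j\<in>Obj J. d j \<in> Hom C (FObj D j) Y) \<and>
     (\<forall>a\<in>Arr J. d (Cod J a) \<cdot>\<^bsub>C\<^esub> FArr D a = d (Dom J a))"

definition colimit :: "('a, 'k, 'x) cat_scheme \<Rightarrow> ('o, 'm, 'y) cat_scheme \<Rightarrow>
    ('a, 'k, 'o, 'm) cfunctor \<Rightarrow> 'o \<Rightarrow> ('a \<Rightarrow> 'm) \<Rightarrow> bool" where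
  "colimit J C D Y d \<longleftrightarrow> cocone J C D Y d \<and>
     (\<forall>Z e. cocone J C D Z e \<longrightarrow>
        (\<exists>!h. h \<in> Hom C Y Z \<and> (\<forall>j\<in>Obj J. h \<cdot>\<^bsub>C\<^esub> d j = e j)))"

definition cone :: "('a, 'k, 'x) cat_scheme \<Rightarrow> ('o, 'm, 'y) cat_scheme \<Rightarrow>
    ('a, 'k, 'o, 'm) cfunctor \<Rightarrow> 'o \<Rightarrow> ('a \<Rightarrow> 'm) \<Rightarrow> bool" where
  "cone J C D X p \<longleftrightarrow> X \<in> Obj C \<and>
     (\<forall>j\<in>Obj J. p j \<in> Hom C X (FObj D j)) \<and>
     (\<forall>a\<in>Arr J. FArr D a \<cdot>\<^bsub>C\<^esub> p (Dom J a) = p (Cod J a))"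

definition limit :: "('a, 'k, 'x) cat_scheme \<Rightarrow> ('o, 'm, 'y) cat_scheme \<Rightarrow>
    ('a, 'k, 'o, 'm) cfunctor \<Rightarrow> 'o \<Rightarrow> ('a \<Rightarrow> 'm) \<Rightarrow> bool" where
  "limit J C D X p \<longleftrightarrow> cone J C D X p \<and>
     (\<forall>Z q. cone J C D Z q \<longrightarrow>
        (\<exists>!h. h \<in> Hom C Z X \<and> (\<forall>j\<in>Obj J. p j \<cdot>\<^bsub>C\<^esub> h = q j)))"

section \<open>Symmetric monoidal categories and compact objects\<close>

text \<open>\<open>\<otimes>\<close> is the tensor on objects and \<open>\<boxtimes>\<close> the tensor on arrows;
  \<open>Assoc C X Y Z : (X \<otimes> Y) \<otimes> Z \<rightarrow> X \<otimes> (Y \<otimes> Z)\<close>.\<close>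

record ('o, 'm) smcat = "('o, 'm) cat" +
  Unit :: "'o"  (\<open>\<I>\<index>\<close>)
  TObj :: "'o \<Rightarrow> 'o \<Rightarrow> 'o"  (infixr \<open>\<otimes>\<index>\<close> 75)
  TArr :: "'m \<Rightarrow> 'm \<Rightarrow> 'm"  (infixr \<open>\<boxtimes>\<index>\<close> 75)
  Assoc :: "'o \<Rightarrow> 'o \<Rightarrow> 'o \<Rightarrow> 'm"
  LUnit :: "'o \<Rightarrow> 'm"
  RUnit :: "'o \<Rightarrow> 'm"
  Braid :: "'o \<Rightarrow> 'o \<Rightarrow> 'm"

locale symmetric_monoidal_category = category C
  for C :: "('o, 'm, 'x) smcat_scheme"  (structure) +
  assumes unit_obj: "\<I> \<in> Obj C"
    and tensor_obj: "X \<in> Obj C \<Longrightarrow> Y \<in> Obj C \<Longrightarrow> X \<otimes> Y \<in> Obj C"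
    and tensor_hom: "f \<in> Hom C X Y \<Longrightarrow> g \<in> Hom C X' Y' \<Longrightarrow> f \<boxtimes> g \<in> Hom C (X \<otimes> X') (Y \<otimes> Y')"
    and tensor_ident: "X \<in> Obj C \<Longrightarrow> Y \<in> Obj C \<Longrightarrow> Ident C X \<boxtimes> Ident C Y = Ident C (X \<otimes> Y)"
    and interchange: "f \<in> Hom C X Y \<Longrightarrow> g \<in> Hom C Y Z \<Longrightarrow> f' \<in> Hom C X' Y' \<Longrightarrow> g' \<in> Hom C Y' Z' \<Longrightarrow>
      (g \<cdot> f) \<boxtimes> (g' \<cdot> f') = (g \<boxtimes> g') \<cdot> (f \<boxtimes> f')"
    and assoc_hom: "X \<in> Obj C \<Longrightarrow> Y \<in> Obj C \<Longrightarrow> Z \<in> Obj C \<Longrightarrow>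
      Assoc C X Y Z \<in> Hom C ((X \<otimes> Y) \<otimes> Z) (X \<otimes> (Y \<otimes> Z))"
    and assoc_iso: "X \<in> Obj C \<Longrightarrow> Y \<in> Obj C \<Longrightarrow> Z \<in> Obj C \<Longrightarrow> iso C (Assoc C X Y Z)"
    and assoc_natural: "f \<in> Hom C X X' \<Longrightarrow> g \<in> Hom C Y Y' \<Longrightarrow> h \<in> Hom C Z Z' \<Longrightarrow>
      Assoc C X' Y' Z' \<cdot> ((f \<boxtimes> g) \<boxtimes> h) = (f \<boxtimes> (g \<boxtimes> h)) \<cdot> Assoc C X Y Z"
    and lunit_hom: "X \<in> Obj C \<Longrightarrow> LUnit C X \<in> Hom C (\<I> \<otimes> X) X"
    and lunit_iso: "X \<in> Obj C \<Longrightarrow> iso C (LUnit C X)"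
    and lunit_natural: "f \<in> Hom C X Y \<Longrightarrow> LUnit C Y \<cdot> (Ident C \<I> \<boxtimes> f) = f \<cdot> LUnit C X"
    and runit_hom: "X \<in> Obj C \<Longrightarrow> RUnit C X \<in> Hom C (X \<otimes> \<I>) X"
    and runit_iso: "X \<in> Obj C \<Longrightarrow> iso C (RUnit C X)"
    and runit_natural: "f \<in> Hom C X Y \<Longrightarrow> RUnit C Y \<cdot> (f \<boxtimes> Ident C \<I>) = f \<cdot> RUnit C X"
    and braid_hom: "X \<in> Obj C \<Longrightarrow> Y \<in> Obj C \<Longrightarrow> Braid C X Y \<in> Hom C (X \<otimes> Y) (Y \<otimes> X)"
    and braid_natural: "f \<in> Hom C X X' \<Longrightarrow> g \<in> Hom C Y Y' \<Longrightarrow>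
      Braid C X' Y' \<cdot> (f \<boxtimes> g) = (g \<boxtimes> f) \<cdot> Braid C X Y"
    and braid_symmetric: "X \<in> Obj C \<Longrightarrow> Y \<in> Obj C \<Longrightarrow>
      Braid C Y X \<cdot> Braid C X Y = Ident C (X \<otimes> Y)"
    and triangle: "X \<in> Obj C \<Longrightarrow> Y \<in> Obj C \<Longrightarrow>
      (Ident C X \<boxtimes> LUnit C Y) \<cdot> Assoc C X \<I> Y = RUnit C X \<boxtimes> Ident C Y"
    and pentagon: "W \<in> Obj C \<Longrightarrow> X \<in> Obj C \<Longrightarrow> Y \<in> Obj C \<Longrightarrow> Z \<in> Obj C \<Longrightarrow>
      (Ident C W \<boxtimes> Assoc C X Y Z) \<cdot> Assoc C W (X \<otimes> Y) Z \<cdot> (Assoc C W X Y \<boxtimes> Ident C Z)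
        = Assoc C W X (Y \<otimes> Z) \<cdot> Assoc C (W \<otimes> X) Y Z"
    and braid_unit: "X \<in> Obj C \<Longrightarrow> LUnit C X \<cdot> Braid C X \<I> = RUnit C X"
    and hexagon: "X \<in> Obj C \<Longrightarrow> Y \<in> Obj C \<Longrightarrow> Z \<in> Obj C \<Longrightarrow>
      Assoc C Y Z X \<cdot> Braid C X (Y \<otimes> Z) \<cdot> Assoc C X Y Z
        = (Ident C Y \<boxtimes> Braid C X Z) \<cdot> Assoc C Y X Z \<cdot> (Braid C X Y \<boxtimes> Ident C Z)"

definition is_dual ::
    "('o, 'm, 'x) smcat_scheme \<Rightarrow> 'o \<Rightarrow> 'o \<Rightarrow> 'm \<Rightarrow> 'm \<Rightarrow> bool" where
  "is_dual C X Y \<eta> \<epsilon> \<longleftrightarrow> X \<in> Obj C \<and> Y \<in> Obj C \<and>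
     \<eta> \<in> Hom C \<I>\<^bsub>C\<^esub> (Y \<otimes>\<^bsub>C\<^esub> X) \<and> \<epsilon> \<in> Hom C (X \<otimes>\<^bsub>C\<^esub> Y) \<I>\<^bsub>C\<^esub> \<and>
     LUnit C X \<cdot>\<^bsub>C\<^esub> (\<epsilon> \<boxtimes>\<^bsub>C\<^esub> Ident C X) \<cdot>\<^bsub>C\<^esub> Inv C (Assoc C X Y X) \<cdot>\<^bsub>C\<^esub>
       (Ident C X \<boxtimes>\<^bsub>C\<^esub> \<eta>) \<cdot>\<^bsub>C\<^esub> Inv C (RUnit C X) = Ident C X \<and>
     RUnit C Y \<cdot>\<^bsub>C\<^esub> (Ident C Y \<boxtimes>\<^bsub>C\<^esub> \<epsilon>) \<cdot>\<^bsub>C\<^esub> Assoc C Y X Y \<cdot>\<^bsub>C\<^esub>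
       (\<eta> \<boxtimes>\<^bsub>C\<^esub> Ident C Y) \<cdot>\<^bsub>C\<^esub> Inv C (LUnit C Y) = Ident C Y"

definition compact_obj :: "('o, 'm, 'x) smcat_scheme \<Rightarrow> 'o \<Rightarrow> bool" where
  "compact_obj C X \<longleftrightarrow> (\<exists>Y \<eta> \<epsilon>. is_dual C X Y \<eta> \<epsilon>)"

record ('o, 'm) duals =
  dual :: "'o \<Rightarrow> 'o"
  coev :: "'o \<Rightarrow> 'm"  (\<open>\<eta>\<index>\<close>)
  ev :: "'o \<Rightarrow> 'm"  (\<open>\<epsilon>\<index>\<close>)

definition choice_of_duals :: "('o, 'm, 'x) smcat_scheme \<Rightarrow> ('o, 'm) duals \<Rightarrow> bool" where
  "choice_of_duals C K \<longleftrightarrow> (\<forall>X. compact_obj C X \<longrightarrow> is_dual C X (dual K X) (coev K X) (ev K X))"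

text \<open>For \<open>f : X \<rightarrow> Y\<close> between compact objects, the arrow \<open>f\<^sup>* : Y\<^sup>* \<rightarrow> X\<^sup>*\<close> given by
  \<open>Y\<^sup>* \<cong> Y\<^sup>* \<otimes> I \<rightarrow> Y\<^sup>* \<otimes> (X \<otimes> X\<^sup>*) \<rightarrow> Y\<^sup>* \<otimes> (Y \<otimes> X\<^sup>*) \<cong> (Y\<^sup>* \<otimes> Y) \<otimes> X\<^sup>* \<rightarrow> I \<otimes> X\<^sup>* \<cong> X\<^sup>*\<close>.
  Since \<open>\<eta>\<^sub>X : I \<rightarrow> X\<^sup>* \<otimes> X\<close> and \<open>\<epsilon>\<^sub>Y : Y \<otimes> Y\<^sup>* \<rightarrow> I\<close>, both are composed with a symmetry.\<close>

definition dual_arr :: "('o, 'm, 'x) smcat_scheme \<Rightarrow> ('o, 'm) duals \<Rightarrow> 'm \<Rightarrow> 'm" where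
  "dual_arr C K f =
     (let X = Dom C f; Y = Cod C f; X' = dual K X; Y' = dual K Y in
        LUnit C X' \<cdot>\<^bsub>C\<^esub>
        ((ev K Y \<cdot>\<^bsub>C\<^esub> Braid C Y' Y) \<boxtimes>\<^bsub>C\<^esub> Ident C X') \<cdot>\<^bsub>C\<^esub>
        Inv C (Assoc C Y' Y X') \<cdot>\<^bsub>C\<^esub>
        (Ident C Y' \<boxtimes>\<^bsub>C\<^esub> (f \<boxtimes>\<^bsub>C\<^esub> Ident C X')) \<cdot>\<^bsub>C\<^esub>
        (Ident C Y' \<boxtimes>\<^bsub>C\<^esub> (Braid C X' X \<cdot>\<^bsub>C\<^esub> coev K X)) \<cdot>\<^bsub>C\<^esub>
        Inv C (RUnit C Y'))"

definition dual_diagram :: "('o, 'm, 'x) smcat_scheme \<Rightarrow> ('o, 'm) duals \<Rightarrow>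
    ('a, 'k, 'o, 'm) cfunctor \<Rightarrow> ('a, 'k, 'o, 'm) cfunctor" where
  "dual_diagram C K D =
     \<lparr>FObj = (\<lambda>j. dual K (FObj D j)), FArr = (\<lambda>a. dual_arr C K (FArr D a))\<rparr>"

section \<open>Compactly accessible categories\<close>

text \<open>Smallness is relative to a set \<open>U\<close>: a set is small if its cardinality is strictly
  below that of \<open>U\<close>. When the cardinality of \<open>U\<close> is strongly inaccessible, these are the
  small sets of the corresponding Grothendieck universe, but \<open>U\<close> may be arbitrary.
  Index sets of diagrams are taken inside the type of \<open>U\<close>, which up to bijection accounts
  for all small sets.\<close>

definition small :: "'u set \<Rightarrow> 'a set \<Rightarrow> bool" where
  "small U A \<longleftrightarrow> A \<prec> U"

definition directed_poset :: "'u set \<Rightarrow> 'u rel \<Rightarrow> bool" where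
  "directed_poset J r \<longleftrightarrow> partial_order_on J r \<and> J \<noteq> {} \<and>
     (\<forall>i\<in>J. \<forall>j\<in>J. \<exists>k\<in>J. (i, k) \<in> r \<and> (j, k) \<in> r)"

definition directed_diagram :: "'u set \<Rightarrow> ('o, 'm, 'x) cat_scheme \<Rightarrow> 'u set \<Rightarrow> 'u rel \<Rightarrow>
    ('u, 'u \<times> 'u, 'o, 'm) cfunctor \<Rightarrow> bool" where
  "directed_diagram U C J r D \<longleftrightarrow>
     small U J \<and> directed_poset J r \<and> is_functor (poset_cat J r) C D"

definition codirected_diagram :: "'u set \<Rightarrow> ('o, 'm, 'x) cat_scheme \<Rightarrow> 'u set \<Rightarrow> 'u rel \<Rightarrow>
    ('u, 'u \<times> 'u, 'o, 'm) cfunctor \<Rightarrow> bool" where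
  "codirected_diagram U C J r D \<longleftrightarrow>
     small U J \<and> directed_poset J r \<and> is_functor (op_cat (poset_cat J r)) C D"

definition weak_factorisation_system ::
    "('o, 'm, 'x) cat_scheme \<Rightarrow> 'm set \<Rightarrow> 'm set \<Rightarrow> bool" where
  "weak_factorisation_system C E M \<longleftrightarrow>
     E \<subseteq> Arr C \<and> M \<subseteq> Arr C \<and>
     (\<forall>f. iso C f \<longrightarrow> f \<in> E \<and> f \<in> M) \<and>
     (\<forall>f\<in>E. \<forall>g\<in>E. Cod C f = Dom C g \<longrightarrow> g \<cdot>\<^bsub>C\<^esub> f \<in> E) \<and>
     (\<forall>f\<in>M. \<forall>g\<in>M. Cod C f = Dom C g \<longrightarrow> g \<cdot>\<^bsub>C\<^esub> f \<in> M) \<and>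
     (\<forall>f\<in>Arr C. \<exists>e\<in>E. \<exists>m\<in>M. Cod C e = Dom C m \<and> f = m \<cdot>\<^bsub>C\<^esub> e) \<and>
     (\<forall>e\<in>E. \<forall>m\<in>M. \<forall>e'\<in>E. \<forall>m'\<in>M. Cod C e = Dom C m \<longrightarrow> Cod C e' = Dom C m' \<longrightarrow>
        (\<forall>u\<in>Hom C (Dom C e) (Dom C e'). \<forall>v\<in>Hom C (Cod C m) (Cod C m').
           v \<cdot>\<^bsub>C\<^esub> m \<cdot>\<^bsub>C\<^esub> e = m' \<cdot>\<^bsub>C\<^esub> e' \<cdot>\<^bsub>C\<^esub> u \<longrightarrow>
           (\<exists>w\<in>Hom C (Cod C e) (Cod C e'). w \<cdot>\<^bsub>C\<^esub> e = e' \<cdot>\<^bsub>C\<^esub> u \<and> m' \<cdot>\<^bsub>C\<^esub> w = v \<cdot>\<^bsub>C\<^esub> m)))"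

text \<open>The competing factorisation \<open>n'\<close> is an arbitrary morphism, not required to lie in \<open>M\<close>.\<close>

definition compactly_presentable ::
    "'u set \<Rightarrow> ('o, 'm, 'x) smcat_scheme \<Rightarrow> 'm set \<Rightarrow> 'o \<Rightarrow> bool" where
  "compactly_presentable U C M X \<longleftrightarrow> compact_obj C X \<and>
     (\<forall>J r D Y d. directed_diagram U C J r D \<longrightarrow> (\<forall>j\<in>J. compact_obj C (FObj D j)) \<longrightarrow>
        colimit (poset_cat J r) C D Y d \<longrightarrow>
        (\<forall>m \<in> M \<inter> Hom C X Y. \<exists>j\<in>J. \<exists>n \<in> M \<inter> Hom C X (FObj D j).
           m = d j \<cdot>\<^bsub>C\<^esub> n \<and>
           (\<forall>n' \<in> Hom C X (FObj D j). d j \<cdot>\<^bsub>C\<^esub> n = d j \<cdot>\<^bsub>C\<^esub> n' \<longrightarrow>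
              (\<exists>j'. (j, j') \<in> r \<and> FArr D (j, j') \<cdot>\<^bsub>C\<^esub> n = FArr D (j, j') \<cdot>\<^bsub>C\<^esub> n'))))"

definition compactly_presentable_wfs ::
    "'u set \<Rightarrow> ('o, 'm, 'x) smcat_scheme \<Rightarrow> 'm set \<Rightarrow> 'm set \<Rightarrow> bool" where
  "compactly_presentable_wfs U C E M \<longleftrightarrow> weak_factorisation_system C E M \<and>
     (\<forall>e\<in>E. compactly_presentable U C M (Dom C e) \<longrightarrow> compactly_presentable U C M (Cod C e))"

definition compactly_accessible ::
    "'u set \<Rightarrow> ('o, 'm, 'x) smcat_scheme \<Rightarrow> 'm set \<Rightarrow> 'm set \<Rightarrow> bool" where
  "compactly_accessible U C E M \<longleftrightarrow> symmetric_monoidal_category C \<and>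
     (\<forall>J r (D :: ('u, 'u \<times> 'u, 'o, 'm) cfunctor).
        directed_diagram U C J r D \<longrightarrow> (\<forall>j\<in>J. compact_obj C (FObj D j)) \<longrightarrow>
        (\<exists>Y d. colimit (poset_cat J r) C D Y d)) \<and>
     (\<forall>J r (D :: ('u, 'u \<times> 'u, 'o, 'm) cfunctor).
        codirected_diagram U C J r D \<longrightarrow> (\<forall>j\<in>J. compact_obj C (FObj D j)) \<longrightarrow>
        (\<exists>X p. limit (op_cat (poset_cat J r)) C D X p)) \<and>
     compactly_presentable_wfs U C E M \<and>
     (\<exists>A. small U A \<and> (\<forall>X\<in>A. compactly_presentable U C M X) \<and>
        (\<forall>X\<in>Obj C. \<exists>J r D d. directed_diagram U C J r D \<and> (\<forall>j\<in>J. FObj D j \<in> A) \<and>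
           colimit (poset_cat J r) C D X d))"

section \<open>The dual-morphism construction\<close>

text \<open>For an object \<open>X\<close> with dual \<open>X\<^sup>*\<close>: a directed diagram \<open>D\<close> (index poset \<open>Idx\<close>, \<open>Le\<close>),
  a colimit cocone \<open>Inj j : D(j) \<rightarrow> X\<close> and a limit cone \<open>Proj j : X\<^sup>* \<rightarrow> D(j)\<^sup>*\<close>, the latter
  written \<open>d\<^sub>j\<^sup>*\<close> in informal notation.\<close>

record ('u, 'o, 'm) presentation =
  Idx :: "'u set"
  Le :: "'u rel"
  Dgm :: "('u, 'u \<times> 'u, 'o, 'm) cfunctor"
  Inj :: "'u \<Rightarrow> 'm"
  Proj :: "'u \<Rightarrow> 'm"

abbreviation Shape :: "('u, 'o, 'm) presentation \<Rightarrow> ('u, 'u \<times> 'u) cat" where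
  "Shape S \<equiv> poset_cat (Idx S) (Le S)"

definition dual_presentation :: "'u set \<Rightarrow> ('o, 'm, 'x) smcat_scheme \<Rightarrow> 'm set \<Rightarrow>
    ('o, 'm) duals \<Rightarrow> 'o \<Rightarrow> 'o \<Rightarrow> ('u, 'o, 'm) presentation \<Rightarrow> bool" where
  "dual_presentation U C M K X X' S \<longleftrightarrow>
     directed_diagram U C (Idx S) (Le S) (Dgm S) \<and>
     (\<forall>j\<in>Idx S. compactly_presentable U C M (FObj (Dgm S) j)) \<and>
     colimit (Shape S) C (Dgm S) X (Inj S) \<and>
     limit (op_cat (Shape S)) C (dual_diagram C K (Dgm S)) X' (Proj S)"

text \<open>Factorisations \<open>f \<circ> c\<^sub>i = m\<^sub>i \<circ> f\<^sub>i\<close> and \<open>m\<^sub>i = d\<^sub>j\<^sub>(\<^sub>i\<^sub>) \<circ> n\<^sub>i\<close>, where \<open>c\<close> and \<open>d\<close> are the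
  colimit cocones of \<open>S\<close> and \<open>T\<close>, and \<open>m\<^sub>i : X\<^sub>i \<rightarrow> Y\<close> with \<open>X\<^sub>i = Cod f\<^sub>i\<close>.\<close>

definition factorisation_data :: "('o, 'm, 'x) smcat_scheme \<Rightarrow> 'm set \<Rightarrow> 'm set \<Rightarrow>
    ('u, 'o, 'm) presentation \<Rightarrow> ('u, 'o, 'm) presentation \<Rightarrow> 'm \<Rightarrow>
    ('u \<Rightarrow> 'm) \<Rightarrow> ('u \<Rightarrow> 'm) \<Rightarrow> ('u \<Rightarrow> 'u) \<Rightarrow> ('u \<Rightarrow> 'm) \<Rightarrow> bool" where
  "factorisation_data C E M S T f fs ms js ns \<longleftrightarrow>
     (\<forall>i\<in>Idx S.
        fs i \<in> E \<and> Dom C (fs i) = FObj (Dgm S) i \<and>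
        ms i \<in> M \<inter> Hom C (Cod C (fs i)) (Cod C f) \<and>
        f \<cdot>\<^bsub>C\<^esub> Inj S i = ms i \<cdot>\<^bsub>C\<^esub> fs i \<and>
        js i \<in> Idx T \<and>
        ns i \<in> M \<inter> Hom C (Cod C (fs i)) (FObj (Dgm T) (js i)) \<and>
        ms i = Inj T (js i) \<cdot>\<^bsub>C\<^esub> ns i)"

definition mediates_uniquely :: "('a, 'k, 'x) cat_scheme \<Rightarrow> ('o, 'm, 'y) cat_scheme \<Rightarrow>
    'o \<Rightarrow> ('a \<Rightarrow> 'm) \<Rightarrow> 'o \<Rightarrow> ('a \<Rightarrow> 'm) \<Rightarrow> 'm \<Rightarrow> bool" where
  "mediates_uniquely J C X p Z q g \<longleftrightarrow>
     g \<in> Hom C Z X \<and> (\<forall>j\<in>Obj J. p j \<cdot>\<^bsub>C\<^esub> g = q j) \<and>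
     (\<forall>h\<in>Hom C Z X. (\<forall>j\<in>Obj J. p j \<cdot>\<^bsub>C\<^esub> h = q j) \<longrightarrow> h = g)"

text \<open>\<open>g : Y' \<rightarrow> X'\<close> is the result of the construction applied to \<open>f : X \<rightarrow> Y\<close>, where \<open>S\<close> and
  \<open>T\<close> present \<open>X\<close> and \<open>Y\<close>: factorisations exist, and each choice of them yields a cone and
  has \<open>g\<close> as its mediating morphism.\<close>

definition constructed_dual_arr :: "('o, 'm, 'x) smcat_scheme \<Rightarrow> 'm set \<Rightarrow> 'm set \<Rightarrow>
    ('o, 'm) duals \<Rightarrow> ('u, 'o, 'm) presentation \<Rightarrow> ('u, 'o, 'm) presentation \<Rightarrow>
    'o \<Rightarrow> 'o \<Rightarrow> 'm \<Rightarrow> 'm \<Rightarrow> bool" where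
  "constructed_dual_arr C E M K S T X' Y' f g \<longleftrightarrow>
     (\<exists>fs ms js ns. factorisation_data C E M S T f fs ms js ns) \<and>
     (\<forall>fs ms js ns. factorisation_data C E M S T f fs ms js ns \<longrightarrow>
        (let q = (\<lambda>i. dual_arr C K (fs i) \<cdot>\<^bsub>C\<^esub> dual_arr C K (ns i) \<cdot>\<^bsub>C\<^esub> Proj T (js i)) in
           cone (op_cat (Shape S)) C (dual_diagram C K (Dgm S)) Y' q \<and>
           mediates_uniquely (op_cat (Shape S)) C X' (Proj S) Y' q g))"

end

theory Submission
  imports Defs
begin

text \<open>
  For compact objects \<open>A\<close> and \<open>Z\<close>, pairing with the evaluations identifies both
  \<open>Hom(A, Z\<^sup>*)\<close> and \<open>Hom(Z, A\<^sup>*)\<close> with \<open>Hom(A \<otimes> Z, I)\<close>, naturally in \<open>A\<close>. If \<open>X\<^sup>*\<close> is a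
  limit of \<open>C(i)\<^sup>*\<close> for a directed colimit \<open>X\<close> of compact objects \<open>C(i)\<close>, passing to the limit
  gives \<open>Hom(X, Z\<^sup>*) \<cong> Hom(Z, X\<^sup>*)\<close> for every compact \<open>Z\<close>. Under this bijection each
  \<open>f\<^sub>i\<^sup>* \<circ> n\<^sub>i\<^sup>* \<circ> d\<^sub>j\<^sup>*\<close> acts as precomposition with \<open>d\<^sub>j \<circ> n\<^sub>i \<circ> f\<^sub>i = f \<circ> c\<^sub>i\<close>, whatever factorisations
  were chosen. Every object is a colimit of compact ones, so morphisms are determined by their
  composites with morphisms out of compact objects; hence these morphisms form a cone, and \<open>f\<^sup>*\<close> is
  the unique morphism acting as precomposition with \<open>f\<close>. Functoriality and agreement with the duals
  of compact objects follow at once. For compact \<open>X\<close> the same test against compact objects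
  shows that the chosen dual is itself a limit of the dual diagram.
\<close>

section \<open>Symmetric monoidal coherence\<close>

context category
begin

lemma in_Hom_iff: "f \<in> Hom C X Y \<longleftrightarrow> f \<in> Arr C \<and> Dom C f = X \<and> Cod C f = Y"
  by (auto simp: Hom_def)

text \<open>The axioms speak of \<open>Hom\<close>, whose endpoints a rewriter would have to guess.
  Stated with \<open>Arr\<close>, \<open>Dom\<close> and \<open>Cod\<close>, every typing condition
  becomes an equation that simplification can evaluate.\<close>

lemma comp_arr [simp]:
  assumes "f \<in> Arr C" "g \<in> Arr C" "Cod C f = Dom C g"
  shows "g \<cdot> f \<in> Arr C" "Dom C (g \<cdot> f) = Dom C f" "Cod C (g \<cdot> f) = Cod C g"
  using comp_hom[of f "Dom C f" "Cod C f" g "Cod C g"] assms by (auto simp: in_Hom_iff)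

lemma ident_arr [simp]:
  assumes "X \<in> Obj C"
  shows "Ident C X \<in> Arr C" "Dom C (Ident C X) = X" "Cod C (Ident C X) = X"
  using ident_hom[OF assms] by (auto simp: in_Hom_iff)

lemma assoc_comp [simp]:
  assumes "f \<in> Arr C" "g \<in> Arr C" "h \<in> Arr C" "Cod C f = Dom C g" "Cod C g = Dom C h"
  shows "(h \<cdot> g) \<cdot> f = h \<cdot> (g \<cdot> f)"
  by (rule comp_assoc) (use assms in \<open>auto simp: in_Hom_iff\<close>)

lemma ident_comp [simp]: "f \<in> Arr C \<Longrightarrow> Cod C f = Y \<Longrightarrow> Ident C Y \<cdot> f = f"
  by (rule ident_left) (auto simp: in_Hom_iff)

lemma comp_ident [simp]: "f \<in> Arr C \<Longrightarrow> Dom C f = X \<Longrightarrow> f \<cdot> Ident C X = f"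
  by (rule ident_right) (auto simp: in_Hom_iff)

lemma inverse_arrows_unique:
  assumes "inverse_arrows C f g" "inverse_arrows C f h"
  shows "g = h"
proof -
  have "g = Ident C (Dom C f) \<cdot> g" using assms by (simp add: inverse_arrows_def in_Hom_iff)
  also have "\<dots> = (h \<cdot> f) \<cdot> g" using assms by (simp add: inverse_arrows_def in_Hom_iff del: assoc_comp)
  also have "\<dots> = h \<cdot> (f \<cdot> g)"
    by (rule assoc_comp) (use assms in \<open>auto simp: inverse_arrows_def in_Hom_iff\<close>)
  also have "\<dots> = h" using assms by (simp add: inverse_arrows_def in_Hom_iff)
  finally show ?thesis .
qed

lemma inverse_arrows_Inv: "iso C f \<Longrightarrow> inverse_arrows C f (Inv C f)"
  unfolding iso_def Inv_def by (rule theI') (blast intro: inverse_arrows_unique)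

lemma Inv_arr [simp]:
  assumes "iso C f"
  shows "Inv C f \<in> Arr C" "Dom C (Inv C f) = Cod C f" "Cod C (Inv C f) = Dom C f"
    "Inv C f \<cdot> f = Ident C (Dom C f)" "f \<cdot> Inv C f = Ident C (Cod C f)"
  using inverse_arrows_Inv[OF assms] by (auto simp: inverse_arrows_def in_Hom_iff)

lemma iso_arr: "iso C f \<Longrightarrow> f \<in> Arr C"
  by (auto simp: iso_def inverse_arrows_def)

lemma Inv_cancel [simp]:
  assumes "iso C f" "g \<in> Arr C"
  shows "Cod C g = Dom C f \<Longrightarrow> Inv C f \<cdot> f \<cdot> g = g" "Cod C g = Cod C f \<Longrightarrow> f \<cdot> Inv C f \<cdot> g = g"
proof -
  show "Inv C f \<cdot> f \<cdot> g = g" if "Cod C g = Dom C f"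
    using that assms assoc_comp[of g f "Inv C f"] by (simp add: iso_arr del: assoc_comp)
  show "f \<cdot> Inv C f \<cdot> g = g" if "Cod C g = Cod C f"
    using that assms assoc_comp[of g "Inv C f" f] by (simp add: iso_arr del: assoc_comp)
qed

lemma iso_epi:
  assumes "g \<cdot> f = h \<cdot> f" "iso C f" "g \<in> Arr C" "h \<in> Arr C" "Dom C g = Cod C f" "Dom C h = Cod C f"
  shows "g = h"
proof -
  have "(g \<cdot> f) \<cdot> Inv C f = (h \<cdot> f) \<cdot> Inv C f" using assms(1) by simp
  then show ?thesis using assms(2-) by (simp add: iso_arr)
qed

lemma iso_mono:
  assumes "f \<cdot> g = f \<cdot> h" "iso C f" "g \<in> Arr C" "h \<in> Arr C" "Cod C g = Dom C f" "Cod C h = Dom C f"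
  shows "g = h"
proof -
  have "Inv C f \<cdot> f \<cdot> g = Inv C f \<cdot> f \<cdot> h" using assms(1) by simp
  then show ?thesis using assms(2-) by (simp add: iso_arr)
qed

text \<open>Composites are normalised to the right, so an equation for \<open>a \<cdot> b\<close>
  stops matching once a further factor follows; this form absorbs that factor.\<close>

lemma comp_tail:
  assumes "a \<cdot> b = c" "a \<in> Arr C" "b \<in> Arr C" "x \<in> Arr C" "Cod C x = Dom C b" "Cod C b = Dom C a"
  shows "a \<cdot> b \<cdot> x = c \<cdot> x"
  using assms assoc_comp[of x b a] by simp

end

section \<open>Tensor calculus and unit coherence\<close>

context symmetric_monoidal_category
begin

lemmas [simp] = unit_obj tensor_obj assoc_iso lunit_iso runit_iso dom_closed cod_closed

lemma tensor_arr [simp]: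
  assumes "f \<in> Arr C" "g \<in> Arr C"
  shows "f \<boxtimes> g \<in> Arr C" "Dom C (f \<boxtimes> g) = Dom C f \<otimes> Dom C g" "Cod C (f \<boxtimes> g) = Cod C f \<otimes> Cod C g"
  using tensor_hom[of f "Dom C f" "Cod C f" g "Dom C g" "Cod C g"] assms by (auto simp: in_Hom_iff)

lemma Assoc_arr [simp]:
  assumes "X \<in> Obj C" "Y \<in> Obj C" "Z \<in> Obj C"
  shows "Assoc C X Y Z \<in> Arr C" "Dom C (Assoc C X Y Z) = (X \<otimes> Y) \<otimes> Z"
    "Cod C (Assoc C X Y Z) = X \<otimes> (Y \<otimes> Z)"
  using assoc_hom[OF assms] by (auto simp: in_Hom_iff)

lemma unit_braid_arr [simp]:
  assumes "X \<in> Obj C"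
  shows "LUnit C X \<in> Arr C" "Dom C (LUnit C X) = \<I> \<otimes> X" "Cod C (LUnit C X) = X"
    "RUnit C X \<in> Arr C" "Dom C (RUnit C X) = X \<otimes> \<I>" "Cod C (RUnit C X) = X"
    "Y \<in> Obj C \<Longrightarrow> Braid C X Y \<in> Arr C" "Y \<in> Obj C \<Longrightarrow> Dom C (Braid C X Y) = X \<otimes> Y"
    "Y \<in> Obj C \<Longrightarrow> Cod C (Braid C X Y) = Y \<otimes> X"
  using lunit_hom[OF assms] runit_hom[OF assms] braid_hom[OF assms, of Y] by (auto simp: in_Hom_iff)

lemma tensor_comp:
  assumes "f \<in> Arr C" "g \<in> Arr C" "f' \<in> Arr C" "g' \<in> Arr C" "Cod C f = Dom C g" "Cod C f' = Dom C g'"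
  shows "(g \<boxtimes> g') \<cdot> (f \<boxtimes> f') = (g \<cdot> f) \<boxtimes> (g' \<cdot> f')"
  by (rule interchange[symmetric]) (use assms in \<open>auto simp: in_Hom_iff\<close>)

lemma tensor_comp_tail:
  assumes "f \<in> Arr C" "g \<in> Arr C" "f' \<in> Arr C" "g' \<in> Arr C" "Cod C f = Dom C g" "Cod C f' = Dom C g'"
    "x \<in> Arr C" "Cod C x = Dom C f \<otimes> Dom C f'"
  shows "(g \<boxtimes> g') \<cdot> (f \<boxtimes> f') \<cdot> x = ((g \<cdot> f) \<boxtimes> (g' \<cdot> f')) \<cdot> x"
  using assms by (intro comp_tail tensor_comp) auto

lemma iso_tensor [simp]:
  assumes "iso C f" "iso C g"
  shows "iso C (f \<boxtimes> g)"
  unfolding iso_def inverse_arrows_def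
  by (rule exI[of _ "Inv C f \<boxtimes> Inv C g"])
    (use assms in \<open>auto simp: in_Hom_iff iso_arr tensor_comp tensor_ident\<close>)

lemma iso_ident [simp]: "X \<in> Obj C \<Longrightarrow> iso C (Ident C X)"
  unfolding iso_def inverse_arrows_def by (rule exI[of _ "Ident C X"]) (auto simp: in_Hom_iff)

lemma iso_Inv [simp]: "iso C f \<Longrightarrow> iso C (Inv C f)"
  unfolding iso_def[of _ "Inv C f"] inverse_arrows_def
  by (rule exI[of _ f]) (auto simp: in_Hom_iff iso_arr)

text \<open>Tensoring with the unit is naturally isomorphic to the identity functor through
  \<open>LUnit\<close>, hence faithful.\<close>

lemma unit_tensor_cancel:
  assumes "Ident C \<I> \<boxtimes> f = Ident C \<I> \<boxtimes> g" "f \<in> Hom C X Y" "g \<in> Hom C X Y"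
  shows "f = g"
proof -
  have "f \<cdot> LUnit C X = g \<cdot> LUnit C X"
    using assms lunit_natural[OF assms(2)] lunit_natural[OF assms(3)] by simp
  then show ?thesis using assms(2,3) by (intro iso_epi[of f "LUnit C X" g]) (auto simp: in_Hom_iff)
qed

lemma tensor_unit_cancel:
  assumes "f \<boxtimes> Ident C \<I> = g \<boxtimes> Ident C \<I>" "f \<in> Hom C X Y" "g \<in> Hom C X Y"
  shows "f = g"
proof -
  have "f \<cdot> RUnit C X = g \<cdot> RUnit C X"
    using assms runit_natural[OF assms(2)] runit_natural[OF assms(3)] by simp
  then show ?thesis using assms(2,3) by (intro iso_epi[of f "RUnit C X" g]) (auto simp: in_Hom_iff)
qed

text \<open>The unit coherences not among the axioms, by Kelly's argument from pentagon and triangle.\<close>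

lemma lunit_tensor:
  assumes [simp]: "X \<in> Obj C" "Y \<in> Obj C"
  shows "LUnit C (X \<otimes> Y) \<cdot> Assoc C \<I> X Y = LUnit C X \<boxtimes> Ident C Y"
proof -
  let ?I = "Ident C \<I>" and ?k = "Assoc C \<I> (\<I> \<otimes> X) Y \<cdot> (Assoc C \<I> \<I> X \<boxtimes> Ident C Y)"
  have k: "iso C (Assoc C \<I> (\<I> \<otimes> X) Y)" "iso C (Assoc C \<I> \<I> X \<boxtimes> Ident C Y)" by simp_all
  \<comment> \<open>Tensored with the unit on the left and composed with the invertible
    \<open>?k\<close>, the left side contains one side of the pentagon at unit, unit,
    \<open>X\<close>, \<open>Y\<close>. Both modifications are cancelled at the end.\<close>
  have "((?I \<boxtimes> (LUnit C (X \<otimes> Y) \<cdot> Assoc C \<I> X Y)) \<cdot> Assoc C \<I> (\<I> \<otimes> X) Y) \<cdot> (Assoc C \<I> \<I> X \<boxtimes> Ident C Y)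
      = (?I \<boxtimes> LUnit C (X \<otimes> Y)) \<cdot> ((?I \<boxtimes> Assoc C \<I> X Y) \<cdot> ?k)"
    by (simp add: tensor_comp_tail)
  also have "\<dots> = ((?I \<boxtimes> LUnit C (X \<otimes> Y)) \<cdot> Assoc C \<I> \<I> (X \<otimes> Y)) \<cdot> Assoc C (\<I> \<otimes> \<I>) X Y"
    by (simp add: pentagon)
  also have "\<dots> = (RUnit C \<I> \<boxtimes> (Ident C X \<boxtimes> Ident C Y)) \<cdot> Assoc C (\<I> \<otimes> \<I>) X Y"
    by (subst triangle) (simp_all add: tensor_ident)
  also have "\<dots> = Assoc C \<I> X Y \<cdot> ((RUnit C \<I> \<boxtimes> Ident C X) \<boxtimes> Ident C Y)"
    by (rule assoc_natural[symmetric]) (auto simp: in_Hom_iff)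
  also have "\<dots> = Assoc C \<I> X Y \<cdot> (((?I \<boxtimes> LUnit C X) \<boxtimes> Ident C Y) \<cdot> (Assoc C \<I> \<I> X \<boxtimes> Ident C Y))"
    by (subst triangle[symmetric]) (simp_all add: tensor_comp)
  also have "\<dots> = (Assoc C \<I> X Y \<cdot> ((?I \<boxtimes> LUnit C X) \<boxtimes> Ident C Y)) \<cdot> (Assoc C \<I> \<I> X \<boxtimes> Ident C Y)"
    by simp
  also have "Assoc C \<I> X Y \<cdot> ((?I \<boxtimes> LUnit C X) \<boxtimes> Ident C Y)
      = (?I \<boxtimes> (LUnit C X \<boxtimes> Ident C Y)) \<cdot> Assoc C \<I> (\<I> \<otimes> X) Y"
    by (rule assoc_natural) (auto simp: in_Hom_iff)
  finally have "?I \<boxtimes> (LUnit C (X \<otimes> Y) \<cdot> Assoc C \<I> X Y) = ?I \<boxtimes> (LUnit C X \<boxtimes> Ident C Y)"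
    by (rule iso_epi[OF iso_epi[OF _ k(2)] k(1)]) simp_all
  then show ?thesis
    by (rule unit_tensor_cancel) (auto simp: in_Hom_iff)
qed

lemma runit_tensor:
  assumes [simp]: "X \<in> Obj C" "Y \<in> Obj C"
  shows "(Ident C X \<boxtimes> RUnit C Y) \<cdot> Assoc C X Y \<I> = RUnit C (X \<otimes> Y)"
proof -
  let ?I = "Ident C \<I>"
  \<comment> \<open>The mirror image: the claim is tensored with the unit on the right, and the
    pentagon is used at \<open>X\<close>, \<open>Y\<close>, unit, unit. The triangle first trades
    \<open>RUnit C Y\<close> for \<open>LUnit C \<I>\<close> and finally trades it back.\<close>
  have "Assoc C X Y \<I> \<cdot> (((Ident C X \<boxtimes> RUnit C Y) \<cdot> Assoc C X Y \<I>) \<boxtimes> ?I)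
      = (Assoc C X Y \<I> \<cdot> ((Ident C X \<boxtimes> RUnit C Y) \<boxtimes> ?I)) \<cdot> (Assoc C X Y \<I> \<boxtimes> ?I)"
    by (simp add: tensor_comp)
  also have "Assoc C X Y \<I> \<cdot> ((Ident C X \<boxtimes> RUnit C Y) \<boxtimes> ?I)
      = (Ident C X \<boxtimes> (RUnit C Y \<boxtimes> ?I)) \<cdot> Assoc C X (Y \<otimes> \<I>) \<I>"
    by (rule assoc_natural) (auto simp: in_Hom_iff)
  also have "RUnit C Y \<boxtimes> ?I = (Ident C Y \<boxtimes> LUnit C \<I>) \<cdot> Assoc C Y \<I> \<I>"
    by (simp add: triangle)
  also have "((Ident C X \<boxtimes> ((Ident C Y \<boxtimes> LUnit C \<I>) \<cdot> Assoc C Y \<I> \<I>)) \<cdot> Assoc C X (Y \<otimes> \<I>) \<I>)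
        \<cdot> (Assoc C X Y \<I> \<boxtimes> ?I)
      = (Ident C X \<boxtimes> (Ident C Y \<boxtimes> LUnit C \<I>)) \<cdot> ((Ident C X \<boxtimes> Assoc C Y \<I> \<I>) \<cdot> Assoc C X (Y \<otimes> \<I>) \<I>
        \<cdot> (Assoc C X Y \<I> \<boxtimes> ?I))"
    by (simp add: tensor_comp_tail)
  also have "\<dots> = ((Ident C X \<boxtimes> (Ident C Y \<boxtimes> LUnit C \<I>)) \<cdot> Assoc C X Y (\<I> \<otimes> \<I>)) \<cdot> Assoc C (X \<otimes> Y) \<I> \<I>"
    by (simp add: pentagon)
  also have "(Ident C X \<boxtimes> (Ident C Y \<boxtimes> LUnit C \<I>)) \<cdot> Assoc C X Y (\<I> \<otimes> \<I>)
      = Assoc C X Y \<I> \<cdot> ((Ident C X \<boxtimes> Ident C Y) \<boxtimes> LUnit C \<I>)"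
    by (rule assoc_natural[symmetric]) (auto simp: in_Hom_iff)
  also have "(Assoc C X Y \<I> \<cdot> ((Ident C X \<boxtimes> Ident C Y) \<boxtimes> LUnit C \<I>)) \<cdot> Assoc C (X \<otimes> Y) \<I> \<I>
      = Assoc C X Y \<I> \<cdot> (RUnit C (X \<otimes> Y) \<boxtimes> ?I)"
    by (simp add: tensor_ident triangle)
  finally have "((Ident C X \<boxtimes> RUnit C Y) \<cdot> Assoc C X Y \<I>) \<boxtimes> ?I = RUnit C (X \<otimes> Y) \<boxtimes> ?I"
    by (rule iso_mono) simp_all
  then show ?thesis
    by (rule tensor_unit_cancel) (auto simp: in_Hom_iff)
qed

lemma lunit_unit: "LUnit C \<I> = RUnit C \<I>"
proof (rule tensor_unit_cancel)
  \<comment> \<open>Naturality of \<open>LUnit\<close> at the arrow \<open>LUnit C \<I>\<close>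
    itself; cancelling the outer copy makes \<open>lunit_tensor\<close> and the triangle
    comparable.\<close>
  have "LUnit C \<I> \<cdot> (Ident C \<I> \<boxtimes> LUnit C \<I>) = LUnit C \<I> \<cdot> LUnit C (\<I> \<otimes> \<I>)"
    by (rule lunit_natural) (auto simp: in_Hom_iff)
  then have "Ident C \<I> \<boxtimes> LUnit C \<I> = LUnit C (\<I> \<otimes> \<I>)" by (rule iso_mono) simp_all
  then show "LUnit C \<I> \<boxtimes> Ident C \<I> = RUnit C \<I> \<boxtimes> Ident C \<I>"
    using lunit_tensor[of \<I> \<I>] triangle[of \<I> \<I>] by simp
qed (auto simp: in_Hom_iff)


text \<open>Both sides realise the permutation taking Z, A, B to B, Z, A. Two hexagons and
  naturality reduce the left side to the right one with \<open>A\<close> and \<open>Z\<close>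
  crossing twice more, and this double crossing vanishes by symmetry.\<close>

lemma braid_braid:
  assumes [simp]: "A \<in> Obj C" "B \<in> Obj C" "Z \<in> Obj C"
  shows "Braid C A (B \<otimes> Z) \<cdot> Assoc C A B Z \<cdot> Braid C Z (A \<otimes> B)
    = (Braid C Z B \<boxtimes> Ident C A) \<cdot> Inv C (Assoc C Z B A) \<cdot> (Ident C Z \<boxtimes> Braid C A B)"
proof (rule iso_mono[of "Assoc C B Z A"])
  have "Assoc C B Z A \<cdot> (Braid C A (B \<otimes> Z) \<cdot> Assoc C A B Z \<cdot> Braid C Z (A \<otimes> B))
      = (Assoc C B Z A \<cdot> Braid C A (B \<otimes> Z) \<cdot> Assoc C A B Z) \<cdot> Braid C Z (A \<otimes> B)"
    by simp
  also have "\<dots> = (Ident C B \<boxtimes> Braid C A Z) \<cdot> Assoc C B A Z \<cdot> ((Braid C A B \<boxtimes> Ident C Z) \<cdot> Braid C Z (A \<otimes> B))"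
    by (subst hexagon) simp_all
  also have "(Braid C A B \<boxtimes> Ident C Z) \<cdot> Braid C Z (A \<otimes> B)
      = Braid C Z (B \<otimes> A) \<cdot> (Ident C Z \<boxtimes> Braid C A B)"
    by (rule braid_natural[symmetric]) (simp_all add: in_Hom_iff)
  also have "(Ident C B \<boxtimes> Braid C A Z) \<cdot> Assoc C B A Z \<cdot> (Braid C Z (B \<otimes> A) \<cdot> (Ident C Z \<boxtimes> Braid C A B))
      = (Ident C B \<boxtimes> Braid C A Z) \<cdot> (Assoc C B A Z \<cdot> Braid C Z (B \<otimes> A) \<cdot> Assoc C Z B A)
        \<cdot> Inv C (Assoc C Z B A) \<cdot> (Ident C Z \<boxtimes> Braid C A B)"
    by simp
  also have "\<dots> = ((Ident C B \<boxtimes> Braid C A Z) \<cdot> (Ident C B \<boxtimes> Braid C Z A)) \<cdot> Assoc C B Z A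
        \<cdot> (Braid C Z B \<boxtimes> Ident C A) \<cdot> Inv C (Assoc C Z B A) \<cdot> (Ident C Z \<boxtimes> Braid C A B)"
    by (subst hexagon) simp_all
  also have "\<dots> = Assoc C B Z A \<cdot> ((Braid C Z B \<boxtimes> Ident C A) \<cdot> Inv C (Assoc C Z B A) \<cdot> (Ident C Z \<boxtimes> Braid C A B))"
    by (subst tensor_comp) (simp_all add: braid_symmetric tensor_ident)
  finally show "Assoc C B Z A \<cdot> (Braid C A (B \<otimes> Z) \<cdot> Assoc C A B Z \<cdot> Braid C Z (A \<otimes> B))
      = Assoc C B Z A \<cdot> ((Braid C Z B \<boxtimes> Ident C A) \<cdot> Inv C (Assoc C Z B A) \<cdot> (Ident C Z \<boxtimes> Braid C A B))" .
qed simp_all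

section \<open>The pairing with a dual object\<close>

text \<open>Inverse of \<open>g \<mapsto> \<epsilon> \<circ> (X \<otimes> g)\<close>. \<open>curry_dual_braid\<close> brings it into the braided shape in which
  \<open>dual_arr\<close> is defined.\<close>

definition curry_dual :: "'o \<Rightarrow> 'o \<Rightarrow> 'm \<Rightarrow> 'o \<Rightarrow> 'm \<Rightarrow> 'm" where
  "curry_dual X X' u Z b = RUnit C X' \<cdot> (Ident C X' \<boxtimes> b) \<cdot> Assoc C X' X Z \<cdot> (u \<boxtimes> Ident C Z) \<cdot> Inv C (LUnit C Z)"

lemma curry_dual_hom:
  assumes "X \<in> Obj C" "X' \<in> Obj C" "Z \<in> Obj C" "u \<in> Hom C \<I> (X' \<otimes> X)" "b \<in> Hom C (X \<otimes> Z) \<I>"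
  shows "curry_dual X X' u Z b \<in> Hom C Z X'"
  using assms by (simp add: curry_dual_def in_Hom_iff)

text \<open>The coherence \<open>braid_unit\<close> trades a right unitor for a left one at either
  end (claims 1 and 2), while naturality carries the braids past \<open>b\<close> and
  \<open>u\<close>. They then meet around the associator, where \<open>braid_braid\<close>
  applies.\<close>

lemma curry_dual_braid:
  assumes [simp]: "X \<in> Obj C" "X' \<in> Obj C" "Z \<in> Obj C" and h: "u \<in> Hom C \<I> (X' \<otimes> X)" and b: "b \<in> Hom C (X \<otimes> Z) \<I>"
  shows "curry_dual X X' u Z b = LUnit C X' \<cdot> ((b \<cdot> Braid C Z X) \<boxtimes> Ident C X') \<cdot> Inv C (Assoc C Z X X')
     \<cdot> (Ident C Z \<boxtimes> (Braid C X' X \<cdot> u)) \<cdot> Inv C (RUnit C Z)"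
proof -
  note [simp] = h[unfolded in_Hom_iff] b[unfolded in_Hom_iff]
  have 1: "RUnit C X' \<cdot> (Ident C X' \<boxtimes> b) = LUnit C X' \<cdot> (b \<boxtimes> Ident C X') \<cdot> Braid C X' (X \<otimes> Z)"
  proof -
    have "RUnit C X' \<cdot> (Ident C X' \<boxtimes> b) = LUnit C X' \<cdot> (Braid C X' \<I> \<cdot> (Ident C X' \<boxtimes> b))"
      by (subst braid_unit[symmetric]) simp_all
    also have "Braid C X' \<I> \<cdot> (Ident C X' \<boxtimes> b) = (b \<boxtimes> Ident C X') \<cdot> Braid C X' (X \<otimes> Z)"
      by (rule braid_natural) (simp_all add: in_Hom_iff)
    finally show ?thesis .
  qed
  have 2: "(u \<boxtimes> Ident C Z) \<cdot> Inv C (LUnit C Z) = Braid C Z (X' \<otimes> X) \<cdot> (Ident C Z \<boxtimes> u) \<cdot> Inv C (RUnit C Z)"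
  proof (rule iso_epi[of _ "RUnit C Z"])
    have "((u \<boxtimes> Ident C Z) \<cdot> Inv C (LUnit C Z)) \<cdot> RUnit C Z = (u \<boxtimes> Ident C Z) \<cdot> Braid C Z \<I>"
      by (subst braid_unit[symmetric]) simp_all
    also have "\<dots> = Braid C Z (X' \<otimes> X) \<cdot> (Ident C Z \<boxtimes> u)"
      by (rule braid_natural[symmetric]) (simp_all add: in_Hom_iff)
    finally show "((u \<boxtimes> Ident C Z) \<cdot> Inv C (LUnit C Z)) \<cdot> RUnit C Z
        = (Braid C Z (X' \<otimes> X) \<cdot> (Ident C Z \<boxtimes> u) \<cdot> Inv C (RUnit C Z)) \<cdot> RUnit C Z"
      by simp
  qed simp_all
  have "curry_dual X X' u Z b = (RUnit C X' \<cdot> (Ident C X' \<boxtimes> b)) \<cdot> Assoc C X' X Z \<cdot> ((u \<boxtimes> Ident C Z) \<cdot> Inv C (LUnit C Z))"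
    by (simp add: curry_dual_def)
  also have "\<dots> = LUnit C X' \<cdot> (b \<boxtimes> Ident C X') \<cdot> (Braid C X' (X \<otimes> Z) \<cdot> Assoc C X' X Z \<cdot> Braid C Z (X' \<otimes> X))
       \<cdot> (Ident C Z \<boxtimes> u) \<cdot> Inv C (RUnit C Z)"
    unfolding 1 2 by simp
  also have "\<dots> = LUnit C X' \<cdot> ((b \<boxtimes> Ident C X') \<cdot> (Braid C Z X \<boxtimes> Ident C X')) \<cdot> Inv C (Assoc C Z X X')
       \<cdot> ((Ident C Z \<boxtimes> Braid C X' X) \<cdot> (Ident C Z \<boxtimes> u)) \<cdot> Inv C (RUnit C Z)"
    by (subst braid_braid) simp_all
  also have "\<dots> = LUnit C X' \<cdot> ((b \<cdot> Braid C Z X) \<boxtimes> Ident C X') \<cdot> Inv C (Assoc C Z X X')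
     \<cdot> (Ident C Z \<boxtimes> (Braid C X' X \<cdot> u)) \<cdot> Inv C (RUnit C Z)"
    by (simp add: tensor_comp)
  finally show ?thesis .
qed

lemma is_dual_arr:
  assumes "is_dual C X X' u e"
  shows "X \<in> Obj C" "X' \<in> Obj C"
    "u \<in> Arr C" "Dom C u = \<I>" "Cod C u = X' \<otimes> X" "e \<in> Arr C" "Dom C e = X \<otimes> X'" "Cod C e = \<I>"
  using assms by (auto simp: is_dual_def in_Hom_iff)

text \<open>One inverse law for the bijection between arrows from \<open>Z\<close> to
  \<open>X'\<close> and arrows from \<open>X \<otimes> Z\<close> to the unit, coming from the first
  triangle identity.\<close>

lemma pairing_curry_dual:
  assumes d: "is_dual C X X' u e" and [simp]: "Z \<in> Obj C" and b: "b \<in> Hom C (X \<otimes> Z) \<I>"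
  shows "e \<cdot> (Ident C X \<boxtimes> curry_dual X X' u Z b) = b"
proof -
  note [simp] = is_dual_arr[OF d] b[unfolded in_Hom_iff]
  have snake: "LUnit C X \<cdot> (e \<boxtimes> Ident C X) \<cdot> Inv C (Assoc C X X' X) \<cdot> (Ident C X \<boxtimes> u) = RUnit C X"
    by (rule iso_epi[of _ "Inv C (RUnit C X)"]) (use d in \<open>simp_all add: is_dual_def\<close>)
  \<comment> \<open>Interchange of \<open>e\<close> and \<open>b\<close>: the arrow \<open>b\<close>
    is moved to the very end, so that \<open>e\<close> faces \<open>u\<close>. The step needs the
    two unitors to agree at the unit object.\<close>
  have 1: "e \<cdot> (Ident C X \<boxtimes> RUnit C X') \<cdot> (Ident C X \<boxtimes> (Ident C X' \<boxtimes> b))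
      = b \<cdot> LUnit C (X \<otimes> Z) \<cdot> (e \<boxtimes> Ident C (X \<otimes> Z)) \<cdot> Inv C (Assoc C X X' (X \<otimes> Z))" (is "?l = ?r")
  proof (rule iso_epi[of _ "Assoc C X X' (X \<otimes> Z)"])
    have "?l \<cdot> Assoc C X X' (X \<otimes> Z)
        = e \<cdot> (Ident C X \<boxtimes> RUnit C X') \<cdot> ((Ident C X \<boxtimes> (Ident C X' \<boxtimes> b)) \<cdot> Assoc C X X' (X \<otimes> Z))"
      by simp
    also have "(Ident C X \<boxtimes> (Ident C X' \<boxtimes> b)) \<cdot> Assoc C X X' (X \<otimes> Z)
        = Assoc C X X' \<I> \<cdot> ((Ident C X \<boxtimes> Ident C X') \<boxtimes> b)"
      by (rule assoc_natural[symmetric]) (simp_all add: in_Hom_iff)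
    also have "e \<cdot> (Ident C X \<boxtimes> RUnit C X') \<cdot> (Assoc C X X' \<I> \<cdot> ((Ident C X \<boxtimes> Ident C X') \<boxtimes> b))
        = e \<cdot> ((Ident C X \<boxtimes> RUnit C X') \<cdot> Assoc C X X' \<I>) \<cdot> (Ident C (X \<otimes> X') \<boxtimes> b)"
      by (simp add: tensor_ident)
    also have "\<dots> = (e \<cdot> RUnit C (X \<otimes> X')) \<cdot> (Ident C (X \<otimes> X') \<boxtimes> b)"
      by (subst runit_tensor) simp_all
    also have "e \<cdot> RUnit C (X \<otimes> X') = RUnit C \<I> \<cdot> (e \<boxtimes> Ident C \<I>)"
      by (rule runit_natural[symmetric]) (simp add: in_Hom_iff)
    also have "(RUnit C \<I> \<cdot> (e \<boxtimes> Ident C \<I>)) \<cdot> (Ident C (X \<otimes> X') \<boxtimes> b)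
        = (LUnit C \<I> \<cdot> (Ident C \<I> \<boxtimes> b)) \<cdot> (e \<boxtimes> Ident C (X \<otimes> Z))"
      by (simp add: tensor_comp lunit_unit)
    also have "LUnit C \<I> \<cdot> (Ident C \<I> \<boxtimes> b) = b \<cdot> LUnit C (X \<otimes> Z)"
      by (rule lunit_natural) (simp add: in_Hom_iff)
    finally show "?l \<cdot> Assoc C X X' (X \<otimes> Z) = ?r \<cdot> Assoc C X X' (X \<otimes> Z)"
      by simp
  qed simp_all
  let ?R = "(Ident C X \<boxtimes> Assoc C X' X Z) \<cdot> (Ident C X \<boxtimes> (u \<boxtimes> Ident C Z)) \<cdot> (Ident C X \<boxtimes> Inv C (LUnit C Z))"
  let ?L = "LUnit C (X \<otimes> Z) \<cdot> (e \<boxtimes> Ident C (X \<otimes> Z)) \<cdot> Inv C (Assoc C X X' (X \<otimes> Z))"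
  let ?W = "(Inv C (Assoc C X X' X) \<boxtimes> Ident C Z) \<cdot> ((Ident C X \<boxtimes> u) \<boxtimes> Ident C Z)"
  \<comment> \<open>The zigzag of \<open>e\<close> and \<open>u\<close> on \<open>X\<close>, with
    \<open>Z\<close> as a spectator. The pentagon regroups the four factors so that
    \<open>snake\<close> can be applied inside \<open>- \<boxtimes> Ident C Z\<close>.\<close>
  have 2: "?L \<cdot> ?R = Ident C (X \<otimes> Z)"
  proof (rule iso_epi[of _ "RUnit C X \<boxtimes> Ident C Z"])
    have "?R \<cdot> (RUnit C X \<boxtimes> Ident C Z)
      = (Ident C X \<boxtimes> Assoc C X' X Z) \<cdot> (Ident C X \<boxtimes> (u \<boxtimes> Ident C Z)) \<cdot> Assoc C X \<I> Z"
      by (subst triangle[symmetric]) (simp_all add: tensor_comp_tail tensor_ident)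
    also have "(Ident C X \<boxtimes> (u \<boxtimes> Ident C Z)) \<cdot> Assoc C X \<I> Z
        = Assoc C X (X' \<otimes> X) Z \<cdot> ((Ident C X \<boxtimes> u) \<boxtimes> Ident C Z)"
      by (rule assoc_natural[symmetric]) (simp_all add: in_Hom_iff)
    also have "(Ident C X \<boxtimes> Assoc C X' X Z) \<cdot> (Assoc C X (X' \<otimes> X) Z \<cdot> ((Ident C X \<boxtimes> u) \<boxtimes> Ident C Z))
        = ((Ident C X \<boxtimes> Assoc C X' X Z) \<cdot> Assoc C X (X' \<otimes> X) Z \<cdot> (Assoc C X X' X \<boxtimes> Ident C Z)) \<cdot> ?W"
      by (simp add: tensor_comp_tail tensor_comp)
    also have "\<dots> = Assoc C X X' (X \<otimes> Z) \<cdot> Assoc C (X \<otimes> X') X Z \<cdot> ?W"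
      by (subst pentagon) simp_all
    finally have "(?L \<cdot> ?R) \<cdot> (RUnit C X \<boxtimes> Ident C Z)
        = LUnit C (X \<otimes> Z) \<cdot> ((e \<boxtimes> Ident C (X \<otimes> Z)) \<cdot> Assoc C (X \<otimes> X') X Z) \<cdot> ?W"
      by simp
    also have "(e \<boxtimes> Ident C (X \<otimes> Z)) \<cdot> Assoc C (X \<otimes> X') X Z = Assoc C \<I> X Z \<cdot> ((e \<boxtimes> Ident C X) \<boxtimes> Ident C Z)"
      by (subst tensor_ident[symmetric]) (simp_all add: assoc_natural in_Hom_iff)
    also have "LUnit C (X \<otimes> Z) \<cdot> (Assoc C \<I> X Z \<cdot> ((e \<boxtimes> Ident C X) \<boxtimes> Ident C Z)) \<cdot> ?W
        = (LUnit C (X \<otimes> Z) \<cdot> Assoc C \<I> X Z) \<cdot> ((e \<boxtimes> Ident C X) \<boxtimes> Ident C Z) \<cdot> ?W"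
      by simp
    also have "\<dots> = RUnit C X \<boxtimes> Ident C Z"
      by (subst lunit_tensor) (simp_all add: tensor_comp_tail tensor_comp snake)
    finally show "(?L \<cdot> ?R) \<cdot> (RUnit C X \<boxtimes> Ident C Z) = Ident C (X \<otimes> Z) \<cdot> (RUnit C X \<boxtimes> Ident C Z)"
      by simp
  qed simp_all
  have "e \<cdot> (Ident C X \<boxtimes> curry_dual X X' u Z b)
     = (e \<cdot> (Ident C X \<boxtimes> RUnit C X') \<cdot> (Ident C X \<boxtimes> (Ident C X' \<boxtimes> b))) \<cdot> ?R"
    by (simp add: curry_dual_def tensor_comp_tail tensor_comp)
  also have "\<dots> = b \<cdot> (?L \<cdot> ?R)"
    unfolding 1 by simp
  also have "\<dots> = b"
    unfolding 2 by simp
  finally show ?thesis .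
qed

text \<open>The other inverse law: \<open>g\<close> slides to the far right past \<open>u\<close>
  and the associator, and what remains is the second triangle identity.\<close>

lemma curry_dual_pairing:
  assumes d: "is_dual C X X' u e" and [simp]: "Z \<in> Obj C" and g: "g \<in> Hom C Z X'"
  shows "curry_dual X X' u Z (e \<cdot> (Ident C X \<boxtimes> g)) = g"
proof -
  note [simp] = is_dual_arr[OF d] g[unfolded in_Hom_iff]
  have 1: "(Ident C \<I> \<boxtimes> g) \<cdot> Inv C (LUnit C Z) = Inv C (LUnit C X') \<cdot> g"
  proof (rule iso_epi[of _ "LUnit C Z"], rule iso_mono[of "LUnit C X'"])
    show "LUnit C X' \<cdot> ((Ident C \<I> \<boxtimes> g) \<cdot> Inv C (LUnit C Z)) \<cdot> LUnit C Z
        = LUnit C X' \<cdot> (Inv C (LUnit C X') \<cdot> g) \<cdot> LUnit C Z"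
      by (simp add: lunit_natural[OF g])
  qed simp_all
  have "curry_dual X X' u Z (e \<cdot> (Ident C X \<boxtimes> g))
     = RUnit C X' \<cdot> (Ident C X' \<boxtimes> e) \<cdot> ((Ident C X' \<boxtimes> (Ident C X \<boxtimes> g)) \<cdot> Assoc C X' X Z)
       \<cdot> (u \<boxtimes> Ident C Z) \<cdot> Inv C (LUnit C Z)"
    by (simp add: curry_dual_def tensor_comp_tail tensor_comp)
  also have "(Ident C X' \<boxtimes> (Ident C X \<boxtimes> g)) \<cdot> Assoc C X' X Z = Assoc C X' X X' \<cdot> (Ident C (X' \<otimes> X) \<boxtimes> g)"
    by (subst tensor_ident[symmetric]) (simp_all add: assoc_natural in_Hom_iff)
  also have "RUnit C X' \<cdot> (Ident C X' \<boxtimes> e) \<cdot> (Assoc C X' X X' \<cdot> (Ident C (X' \<otimes> X) \<boxtimes> g))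
       \<cdot> (u \<boxtimes> Ident C Z) \<cdot> Inv C (LUnit C Z)
     = RUnit C X' \<cdot> (Ident C X' \<boxtimes> e) \<cdot> Assoc C X' X X'
       \<cdot> (u \<boxtimes> Ident C X') \<cdot> ((Ident C \<I> \<boxtimes> g) \<cdot> Inv C (LUnit C Z))"
    by (simp add: tensor_comp_tail)
  also have "\<dots> = (RUnit C X' \<cdot> (Ident C X' \<boxtimes> e) \<cdot> Assoc C X' X X' \<cdot> (u \<boxtimes> Ident C X') \<cdot> Inv C (LUnit C X')) \<cdot> g"
    unfolding 1 by simp
  also have "\<dots> = g"
    using d by (simp add: is_dual_def del: assoc_comp)
  finally show ?thesis .
qed

lemma pairing_ex1:
  assumes d: "is_dual C X X' u e" and "Z \<in> Obj C" "b \<in> Hom C (X \<otimes> Z) \<I>"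
  shows "\<exists>!g. g \<in> Hom C Z X' \<and> e \<cdot> (Ident C X \<boxtimes> g) = b"
proof (rule ex1I[of _ "curry_dual X X' u Z b"])
  show "curry_dual X X' u Z b \<in> Hom C Z X' \<and> e \<cdot> (Ident C X \<boxtimes> curry_dual X X' u Z b) = b"
    using assms is_dual_arr[OF d] by (simp add: pairing_curry_dual curry_dual_hom in_Hom_iff[of u])
qed (use curry_dual_pairing[OF d] assms in auto)

text \<open>The second triangle identity says that \<open>curry_dual\<close> sends the evaluation to
  the identity, and \<open>curry_dual_braid\<close> rewrites such a statement in the shape of the
  first. Under the braiding the two triangle identities therefore change places.\<close>

lemma is_dual_swap:
  assumes d: "is_dual C X X' u e"
  shows "is_dual C X' X (Braid C X' X \<cdot> u) (e \<cdot> Braid C X' X)"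
proof -
  note [simp] = is_dual_arr[OF d]
  have bb: "Braid C X X' \<cdot> Braid C X' X \<cdot> u = u" "e \<cdot> Braid C X' X \<cdot> Braid C X X' = e"
    using comp_tail[OF braid_symmetric[of X' X], of u] by (simp_all add: braid_symmetric)
  have "curry_dual X X' u X' e = Ident C X'"
    using d by (simp add: curry_dual_def is_dual_def)
  moreover have "curry_dual X' X (Braid C X' X \<cdot> u) X (e \<cdot> Braid C X' X) = Ident C X"
    using d by (subst curry_dual_braid) (simp_all add: bb in_Hom_iff is_dual_def)
  ultimately show ?thesis
    using curry_dual_braid[of X X' X' u e]
    by (simp add: is_dual_def in_Hom_iff curry_dual_def[of X' X])
qed

text \<open>Precomposition with the braiding is invertible by symmetry and turns the equation for
  \<open>k\<close> into the one solved by \<open>pairing_ex1\<close>; the variable now sits in the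
  left tensor slot.\<close>

lemma braid_pairing_ex1:
  assumes d: "is_dual C Z Z' u e" and [simp]: "A \<in> Obj C" and b: "b \<in> Hom C (A \<otimes> Z) \<I>"
  shows "\<exists>!k. k \<in> Hom C A Z' \<and> (e \<cdot> Braid C Z' Z) \<cdot> (k \<boxtimes> Ident C Z) = b"
proof -
  note [simp] = is_dual_arr[OF d] b[unfolded in_Hom_iff]
  have "(e \<cdot> Braid C Z' Z) \<cdot> (k \<boxtimes> Ident C Z) = b \<longleftrightarrow> e \<cdot> (Ident C Z \<boxtimes> k) = b \<cdot> Braid C Z A"
    if k: "k \<in> Hom C A Z'" for k
  proof -
    note [simp] = k[unfolded in_Hom_iff]
    have n: "Braid C Z' Z \<cdot> (k \<boxtimes> Ident C Z) = (Ident C Z \<boxtimes> k) \<cdot> Braid C A Z"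
      by (rule braid_natural) (simp_all add: in_Hom_iff)
    have "(e \<cdot> Braid C Z' Z) \<cdot> (k \<boxtimes> Ident C Z) = (e \<cdot> (Ident C Z \<boxtimes> k)) \<cdot> Braid C A Z"
      by (simp add: n)
    moreover have "((e \<cdot> (Ident C Z \<boxtimes> k)) \<cdot> Braid C A Z) \<cdot> Braid C Z A = e \<cdot> (Ident C Z \<boxtimes> k)"
      by (simp add: braid_symmetric)
    moreover have "(b \<cdot> Braid C Z A) \<cdot> Braid C A Z = b"
      by (simp add: braid_symmetric)
    ultimately show ?thesis by metis
  qed
  with pairing_ex1[OF d, of A "b \<cdot> Braid C Z A"] show ?thesis
    by (simp add: in_Hom_iff cong: conj_cong)
qed

end

section \<open>Chosen duals and the dual of an arrow between compact objects\<close>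

locale smc_duals = symmetric_monoidal_category C
  for C :: "('o, 'm, 'x) smcat_scheme" (structure) +
  fixes K :: "('o, 'm) duals"
  assumes choice: "choice_of_duals C K"
begin

lemma dual: "compact_obj C X \<Longrightarrow> is_dual C X (dual K X) (coev K X) (ev K X)"
  using choice by (auto simp: choice_of_duals_def)

lemma compact_arr [simp]:
  assumes "compact_obj C X"
  shows "X \<in> Obj C" "dual K X \<in> Obj C"
    "coev K X \<in> Arr C" "Dom C (coev K X) = \<I>" "Cod C (coev K X) = dual K X \<otimes> X"
    "ev K X \<in> Arr C" "Dom C (ev K X) = X \<otimes> dual K X" "Cod C (ev K X) = \<I>"
  using is_dual_arr[OF dual[OF assms]] by auto

lemma compact_dual [simp]: "compact_obj C X \<Longrightarrow> compact_obj C (dual K X)"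
  unfolding compact_obj_def[of C "dual K X"] by (blast intro: is_dual_swap dual)

lemma pairing_inject:
  assumes "compact_obj C X" "g \<in> Hom C Z (dual K X)" "h \<in> Hom C Z (dual K X)"
    "ev K X \<cdot> (Ident C X \<boxtimes> g) = ev K X \<cdot> (Ident C X \<boxtimes> h)"
  shows "g = h"
proof -
  have "Z \<in> Obj C" using assms(2) by (auto simp: in_Hom_iff)
  moreover have "ev K X \<cdot> (Ident C X \<boxtimes> h) \<in> Hom C (X \<otimes> Z) \<I>"
    using assms by (auto simp: in_Hom_iff)
  ultimately show ?thesis
    using pairing_ex1[OF dual[OF assms(1)]] assms(2-) by metis
qed

text \<open>After \<open>f\<close> is moved through the associator and the braiding, the formula of
  \<open>dual_arr\<close> is the braided form of \<open>curry_dual\<close> at \<open>?b\<close>.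
  Hence \<open>dual_arr\<close> is the transpose of \<open>f\<close> with respect to the
  evaluations, and all later facts about it come from this property.\<close>

lemma dual_arr:
  assumes c: "compact_obj C X" "compact_obj C Y" and f: "f \<in> Hom C X Y"
  shows "dual_arr C K f \<in> Hom C (dual K Y) (dual K X)"
    "ev K X \<cdot> (Ident C X \<boxtimes> dual_arr C K f) = ev K Y \<cdot> (f \<boxtimes> Ident C (dual K Y))"
proof -
  note [simp] = compact_arr[OF c(1)] compact_arr[OF c(2)] f[unfolded in_Hom_iff]
  let ?b = "ev K Y \<cdot> (f \<boxtimes> Ident C (dual K Y))"
  have b: "?b \<in> Hom C (X \<otimes> dual K Y) \<I>" by (simp add: in_Hom_iff)
  have "(f \<boxtimes> Ident C (dual K Y)) \<cdot> Braid C (dual K Y) X = Braid C (dual K Y) Y \<cdot> (Ident C (dual K Y) \<boxtimes> f)"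
    by (rule braid_natural[symmetric]) (simp_all add: in_Hom_iff)
  then have bb: "?b \<cdot> Braid C (dual K Y) X = (ev K Y \<cdot> Braid C (dual K Y) Y) \<cdot> (Ident C (dual K Y) \<boxtimes> f)"
    by simp
  \<comment> \<open>Naturality of the inverse associator, obtained from that of the associator by
    cancelling it on both sides.\<close>
  have n: "Inv C (Assoc C (dual K Y) Y (dual K X)) \<cdot> (Ident C (dual K Y) \<boxtimes> (f \<boxtimes> Ident C (dual K X)))
     = ((Ident C (dual K Y) \<boxtimes> f) \<boxtimes> Ident C (dual K X)) \<cdot> Inv C (Assoc C (dual K Y) X (dual K X))"
  proof (rule iso_epi[of _ "Assoc C (dual K Y) X (dual K X)"], rule iso_mono[of "Assoc C (dual K Y) Y (dual K X)"])
    show "Assoc C (dual K Y) Y (dual K X) \<cdot> (Inv C (Assoc C (dual K Y) Y (dual K X)) \<cdot>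
         (Ident C (dual K Y) \<boxtimes> (f \<boxtimes> Ident C (dual K X)))) \<cdot> Assoc C (dual K Y) X (dual K X)
       = Assoc C (dual K Y) Y (dual K X) \<cdot> (((Ident C (dual K Y) \<boxtimes> f) \<boxtimes> Ident C (dual K X)) \<cdot>
         Inv C (Assoc C (dual K Y) X (dual K X))) \<cdot> Assoc C (dual K Y) X (dual K X)"
      by (simp add: assoc_natural[OF ident_hom f ident_hom])
  qed simp_all
  let ?r = "(Ident C (dual K Y) \<boxtimes> (Braid C (dual K X) X \<cdot> coev K X)) \<cdot> Inv C (RUnit C (dual K Y))"
  have "curry_dual X (dual K X) (coev K X) (dual K Y) ?b = LUnit C (dual K X) \<cdot>
     ((?b \<cdot> Braid C (dual K Y) X) \<boxtimes> Ident C (dual K X)) \<cdot> Inv C (Assoc C (dual K Y) X (dual K X)) \<cdot> ?r"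
    by (subst curry_dual_braid) (simp_all add: in_Hom_iff)
  also have "\<dots> = LUnit C (dual K X) \<cdot> ((ev K Y \<cdot> Braid C (dual K Y) Y) \<boxtimes> Ident C (dual K X)) \<cdot>
     (((Ident C (dual K Y) \<boxtimes> f) \<boxtimes> Ident C (dual K X)) \<cdot> Inv C (Assoc C (dual K Y) X (dual K X))) \<cdot> ?r"
    unfolding bb by (simp add: tensor_comp_tail)
  also have "\<dots> = dual_arr C K f"
    unfolding n[symmetric] by (simp add: dual_arr_def Let_def)
  finally have t: "dual_arr C K f = curry_dual X (dual K X) (coev K X) (dual K Y) ?b" ..
  show "dual_arr C K f \<in> Hom C (dual K Y) (dual K X)"
    unfolding t by (rule curry_dual_hom) (simp_all add: in_Hom_iff)
  show "ev K X \<cdot> (Ident C X \<boxtimes> dual_arr C K f) = ?b"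
    unfolding t by (rule pairing_curry_dual[OF dual[OF c(1)] _ b]) simp
qed

lemma dual_arr_ident:
  assumes "compact_obj C X"
  shows "dual_arr C K (Ident C X) = Ident C (dual K X)"
proof (rule pairing_inject[OF assms])
  have i: "Ident C X \<in> Hom C X X" using assms by (simp add: ident_hom)
  show "dual_arr C K (Ident C X) \<in> Hom C (dual K X) (dual K X)"
    "ev K X \<cdot> (Ident C X \<boxtimes> dual_arr C K (Ident C X)) = ev K X \<cdot> (Ident C X \<boxtimes> Ident C (dual K X))"
    using dual_arr[OF assms assms i] .
qed (use assms in \<open>simp add: ident_hom\<close>)

text \<open>Both arrows have the same pairing with \<open>X\<close>: the duals are traded for
  \<open>f\<close> and then \<open>g\<close>, one evaluation at a time.\<close>

lemma dual_arr_comp: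
  assumes c: "compact_obj C X" "compact_obj C Y" "compact_obj C Z" and f: "f \<in> Hom C X Y" and g: "g \<in> Hom C Y Z"
  shows "dual_arr C K (g \<cdot> f) = dual_arr C K f \<cdot> dual_arr C K g"
proof (rule pairing_inject[OF c(1)])
  note [simp] = compact_arr[OF c(1)] compact_arr[OF c(2)] compact_arr[OF c(3)]
    f[unfolded in_Hom_iff] g[unfolded in_Hom_iff]
    dual_arr(1)[OF c(1,2) f, unfolded in_Hom_iff] dual_arr(1)[OF c(2,3) g, unfolded in_Hom_iff]
  let ?f = "dual_arr C K f" and ?g = "dual_arr C K g"
  have "ev K X \<cdot> (Ident C X \<boxtimes> (?f \<cdot> ?g)) = (ev K X \<cdot> (Ident C X \<boxtimes> ?f)) \<cdot> (Ident C X \<boxtimes> ?g)"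
    by (simp add: tensor_comp)
  also have "\<dots> = (ev K Y \<cdot> (Ident C Y \<boxtimes> ?g)) \<cdot> (f \<boxtimes> Ident C (dual K Z))"
    unfolding dual_arr(2)[OF c(1,2) f] by (simp add: tensor_comp)
  also have "\<dots> = ev K Z \<cdot> ((g \<cdot> f) \<boxtimes> Ident C (dual K Z))"
    unfolding dual_arr(2)[OF c(2,3) g] by (simp add: tensor_comp)
  also have "\<dots> = ev K X \<cdot> (Ident C X \<boxtimes> dual_arr C K (g \<cdot> f))"
    by (rule dual_arr(2)[OF c(1,3) comp_hom[OF f g], symmetric])
  finally show "ev K X \<cdot> (Ident C X \<boxtimes> dual_arr C K (g \<cdot> f)) = ev K X \<cdot> (Ident C X \<boxtimes> (?f \<cdot> ?g))" ..
  show "dual_arr C K (g \<cdot> f) \<in> Hom C (dual K Z) (dual K X)"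
    by (rule dual_arr[OF c(1,3) comp_hom[OF f g]])
  show "?f \<cdot> ?g \<in> Hom C (dual K Z) (dual K X)"
    by (simp add: in_Hom_iff)
qed

end

section \<open>Diagrams over directed posets\<close>

lemma (in category) category_op: "category (op_cat C)"
proof unfold_locales
  fix f g h W X Y Z
  assume f: "f \<in> Hom (op_cat C) W X" and g: "g \<in> Hom (op_cat C) X Y"
  show "g \<cdot>\<^bsub>op_cat C\<^esub> f \<in> Hom (op_cat C) W Y"
    using f g by (auto simp: op_cat_def Hom_def)
  assume h: "h \<in> Hom (op_cat C) Y Z"
  show "(h \<cdot>\<^bsub>op_cat C\<^esub> g) \<cdot>\<^bsub>op_cat C\<^esub> f = h \<cdot>\<^bsub>op_cat C\<^esub> (g \<cdot>\<^bsub>op_cat C\<^esub> f)"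
    using f g h by (auto simp: op_cat_def Hom_def)
qed (auto simp: op_cat_def Hom_def dom_closed cod_closed)

lemma Hom_op_cat: "Hom (op_cat C) X Y = Hom C Y X"
  by (auto simp: Hom_def op_cat_def)

lemma Comp_op_cat: "g \<cdot>\<^bsub>op_cat C\<^esub> f = f \<cdot>\<^bsub>C\<^esub> g"
  by (simp add: op_cat_def)

lemma Obj_poset_cat [simp]: "Obj (poset_cat J r) = J" "Obj (op_cat C) = Obj C"
  by (simp_all add: poset_cat_def op_cat_def)

lemma cocone_poset_iff:
  "cocone (poset_cat J r) C D Y d \<longleftrightarrow> Y \<in> Obj C \<and> (\<forall>j\<in>J. d j \<in> Hom C (FObj D j) Y) \<and>
     (\<forall>i j. (i, j) \<in> r \<longrightarrow> d j \<cdot>\<^bsub>C\<^esub> FArr D (i, j) = d i)"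
  by (auto simp: cocone_def poset_cat_def)

lemma cone_poset_iff:
  "cone (op_cat (poset_cat J r)) C D X p \<longleftrightarrow> X \<in> Obj C \<and> (\<forall>j\<in>J. p j \<in> Hom C X (FObj D j)) \<and>
     (\<forall>i j. (i, j) \<in> r \<longrightarrow> FArr D (i, j) \<cdot>\<^bsub>C\<^esub> p j = p i)"
  by (auto simp: cone_def poset_cat_def op_cat_def)

lemma dual_diagram_simps [simp]:
  "FObj (dual_diagram C K D) j = dual K (FObj D j)"
  "FArr (dual_diagram C K D) a = dual_arr C K (FArr D a)"
  by (simp_all add: dual_diagram_def)

text \<open>That \<open>r\<close> relates only elements of \<open>J\<close> is read off from
  \<open>poset_cat J r\<close> being a category, which is part of the functor condition.\<close>

lemma directed_diagram_le:
  assumes "directed_diagram U C J r D" "(i, j) \<in> r"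
  shows "i \<in> J" "j \<in> J" "FArr D (i, j) \<in> Hom C (FObj D i) (FObj D j)"
proof -
  interpret P: category "poset_cat J r"
    using assms(1) by (simp add: directed_diagram_def is_functor_def)
  show "i \<in> J" "j \<in> J"
    using P.dom_closed[of "(i, j)"] P.cod_closed[of "(i, j)"] assms(2) by (auto simp: poset_cat_def)
  show "FArr D (i, j) \<in> Hom C (FObj D i) (FObj D j)"
    using assms by (auto simp: directed_diagram_def is_functor_def poset_cat_def Hom_def)
qed

context category
begin

lemma colimit_eqI:
  assumes "colimit (poset_cat J r) C D Y d" "f \<in> Hom C Y Z" "g \<in> Hom C Y Z"
    and eq: "\<And>j. j \<in> J \<Longrightarrow> f \<cdot> d j = g \<cdot> d j"
    and D: "directed_diagram U C J r D"
  shows "f = g"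
proof -
  have co: "cocone (poset_cat J r) C D Y d" using assms(1) by (simp add: colimit_def)
  have "cocone (poset_cat J r) C D Z (\<lambda>j. f \<cdot> d j)"
    unfolding cocone_poset_iff
  proof (intro conjI allI impI ballI)
    show "Z \<in> Obj C" using assms(2) cod_closed by (auto simp: in_Hom_iff)
    show "f \<cdot> d j \<in> Hom C (FObj D j) Z" if "j \<in> J" for j
      using co that assms(2) by (auto simp: cocone_poset_iff intro: comp_hom)
    show "(f \<cdot> d j) \<cdot> FArr D (i, j) = f \<cdot> d i" if "(i, j) \<in> r" for i j
      using co directed_diagram_le[OF D that] that assms(2)
      by (subst comp_assoc) (auto simp: cocone_poset_iff)
  qed
  then have "\<exists>!h. h \<in> Hom C Y Z \<and> (\<forall>j\<in>J. h \<cdot> d j = f \<cdot> d j)"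
    using assms(1) by (simp add: colimit_def)
  then show ?thesis using assms(2-3) eq by metis
qed

end

section \<open>Exchanging the two objects of an arrow into a dual\<close>

context smc_duals
begin

text \<open>The bijection \<open>Hom(A, Z\<^sup>*) \<rightarrow> Hom(Z, A\<^sup>*)\<close> through \<open>Hom(A \<otimes> Z, I)\<close>.\<close>

definition flip :: "'o \<Rightarrow> 'o \<Rightarrow> 'm \<Rightarrow> 'm" where
  "flip A Z k = (THE h. h \<in> Hom C Z (dual K A) \<and>
     ev K A \<cdot> (Ident C A \<boxtimes> h) = (ev K Z \<cdot> Braid C (dual K Z) Z) \<cdot> (k \<boxtimes> Ident C Z))"

lemma flip:
  assumes "compact_obj C A" "compact_obj C Z" "k \<in> Hom C A (dual K Z)"
  shows "flip A Z k \<in> Hom C Z (dual K A)"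
    "ev K A \<cdot> (Ident C A \<boxtimes> flip A Z k) = (ev K Z \<cdot> Braid C (dual K Z) Z) \<cdot> (k \<boxtimes> Ident C Z)"
proof -
  note [simp] = compact_arr[OF assms(1)] compact_arr[OF assms(2)] assms(3)[unfolded in_Hom_iff]
  have b: "(ev K Z \<cdot> Braid C (dual K Z) Z) \<cdot> (k \<boxtimes> Ident C Z) \<in> Hom C (A \<otimes> Z) \<I>"
    by (simp add: in_Hom_iff)
  show "flip A Z k \<in> Hom C Z (dual K A)"
    "ev K A \<cdot> (Ident C A \<boxtimes> flip A Z k) = (ev K Z \<cdot> Braid C (dual K Z) Z) \<cdot> (k \<boxtimes> Ident C Z)"
    using theI'[OF pairing_ex1[OF dual[OF assms(1)] _ b]] unfolding flip_def by simp_all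
qed

text \<open>The pairing of \<open>h\<close> is an arrow from \<open>A \<otimes> Z\<close> to the
  unit, and \<open>braid_pairing_ex1\<close> reads it as an arrow from \<open>A\<close> to
  \<open>dual K Z\<close>.\<close>

lemma flip_ex1:
  assumes "compact_obj C A" "compact_obj C Z" and h: "h \<in> Hom C Z (dual K A)"
  shows "\<exists>!k. k \<in> Hom C A (dual K Z) \<and> flip A Z k = h"
proof -
  note [simp] = compact_arr[OF assms(1)] compact_arr[OF assms(2)] assms(3)[unfolded in_Hom_iff]
  have b: "ev K A \<cdot> (Ident C A \<boxtimes> h) \<in> Hom C (A \<otimes> Z) \<I>"
    by (simp add: in_Hom_iff)
  have "flip A Z k = h \<longleftrightarrow>
      (ev K Z \<cdot> Braid C (dual K Z) Z) \<cdot> (k \<boxtimes> Ident C Z) = ev K A \<cdot> (Ident C A \<boxtimes> h)"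
    if "k \<in> Hom C A (dual K Z)" for k
    using flip[OF assms(1,2) that] pairing_inject[OF assms(1) _ h, of "flip A Z k"] by metis
  with braid_pairing_ex1[OF dual[OF assms(2)] _ b] show ?thesis
    by (simp cong: conj_cong del: assoc_comp)
qed

text \<open>Naturality in the first object: under the evaluation at \<open>A\<close>, the dual of
  \<open>a\<close> turns into precomposition with \<open>a\<close>, so both arrows have the same
  pairing.\<close>

lemma flip_comp:
  assumes c: "compact_obj C A" "compact_obj C B" "compact_obj C Z"
    and a: "a \<in> Hom C A B" and k: "k \<in> Hom C B (dual K Z)"
  shows "flip A Z (k \<cdot> a) = dual_arr C K a \<cdot> flip B Z k"
proof (rule pairing_inject[OF c(1)])
  note [simp] = compact_arr[OF c(1)] compact_arr[OF c(2)] compact_arr[OF c(3)]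
    a[unfolded in_Hom_iff] k[unfolded in_Hom_iff] dual_arr(1)[OF c(1,2) a, unfolded in_Hom_iff]
    flip(1)[OF c(2,3) k, unfolded in_Hom_iff]
  have ka: "k \<cdot> a \<in> Hom C A (dual K Z)" by (simp add: in_Hom_iff)
  have "ev K A \<cdot> (Ident C A \<boxtimes> (dual_arr C K a \<cdot> flip B Z k))
      = (ev K A \<cdot> (Ident C A \<boxtimes> dual_arr C K a)) \<cdot> (Ident C A \<boxtimes> flip B Z k)"
    by (simp add: tensor_comp)
  also have "\<dots> = (ev K B \<cdot> (Ident C B \<boxtimes> flip B Z k)) \<cdot> (a \<boxtimes> Ident C Z)"
    unfolding dual_arr(2)[OF c(1,2) a] by (simp add: tensor_comp)
  also have "\<dots> = (ev K Z \<cdot> Braid C (dual K Z) Z) \<cdot> ((k \<cdot> a) \<boxtimes> Ident C Z)"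
    unfolding flip(2)[OF c(2,3) k] by (simp add: tensor_comp)
  also have "\<dots> = ev K A \<cdot> (Ident C A \<boxtimes> flip A Z (k \<cdot> a))"
    by (rule flip(2)[OF c(1,3) ka, symmetric])
  finally show "ev K A \<cdot> (Ident C A \<boxtimes> flip A Z (k \<cdot> a))
     = ev K A \<cdot> (Ident C A \<boxtimes> (dual_arr C K a \<cdot> flip B Z k))" ..
  show "flip A Z (k \<cdot> a) \<in> Hom C Z (dual K A)" by (rule flip[OF c(1,3) ka])
qed (use dual_arr(1)[OF c(1,2) a] flip(1)[OF c(2,3) k] in \<open>rule comp_hom[rotated]\<close>)

lemma flip_inject:
  assumes "compact_obj C A" "compact_obj C Z" "k \<in> Hom C A (dual K Z)" "k' \<in> Hom C A (dual K Z)"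
    "flip A Z k = flip A Z k'"
  shows "k = k'"
  using flip_ex1[OF assms(1,2) flip(1)[OF assms(1-3)]] assms(3-) by metis

text \<open>By naturality of \<open>flip\<close>, a compatible family out of \<open>Z\<close> into
  the duals corresponds to a cocone over \<open>D\<close> with vertex \<open>dual K Z\<close>, which
  factors uniquely through the colimit. The object \<open>X\<close> itself need not be compact
  here.\<close>

lemma flip_colimit:
  assumes D: "directed_diagram U C J r D" "\<And>j. j \<in> J \<Longrightarrow> compact_obj C (FObj D j)"
    and col: "colimit (poset_cat J r) C D X c" and Z: "compact_obj C Z"
    and y: "\<And>j. j \<in> J \<Longrightarrow> y j \<in> Hom C Z (dual K (FObj D j))"
    and y_le: "\<And>i j. (i, j) \<in> r \<Longrightarrow> dual_arr C K (FArr D (i, j)) \<cdot> y j = y i"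
  shows "\<exists>!x. x \<in> Hom C X (dual K Z) \<and> (\<forall>j\<in>J. flip (FObj D j) Z (x \<cdot> c j) = y j)"
proof -
  have "\<forall>j\<in>J. \<exists>k. k \<in> Hom C (FObj D j) (dual K Z) \<and> flip (FObj D j) Z k = y j"
    using flip_ex1[OF D(2) Z y] by blast
  then obtain x where x: "\<And>j. j \<in> J \<Longrightarrow> x j \<in> Hom C (FObj D j) (dual K Z)"
    "\<And>j. j \<in> J \<Longrightarrow> flip (FObj D j) Z (x j) = y j"
    by metis
  have c: "c j \<in> Hom C (FObj D j) X" if "j \<in> J" for j
    using col that by (simp add: colimit_def cocone_poset_iff)
  have "cocone (poset_cat J r) C D (dual K Z) x"
    unfolding cocone_poset_iff
  proof (intro conjI allI impI ballI)
    fix i j assume le: "(i, j) \<in> r"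
    note ij = directed_diagram_le[OF D(1) le]
    show "x j \<cdot> FArr D (i, j) = x i"
    proof (rule flip_inject[OF D(2)[OF ij(1)] Z])
      show "flip (FObj D i) Z (x j \<cdot> FArr D (i, j)) = flip (FObj D i) Z (x i)"
        using flip_comp[OF D(2)[OF ij(1)] D(2)[OF ij(2)] Z ij(3) x(1)] x ij y_le[OF le] by simp
    qed (use x ij in \<open>auto intro: comp_hom\<close>)
  qed (use x Z in auto)
  then have "\<exists>!h. h \<in> Hom C X (dual K Z) \<and> (\<forall>j\<in>J. h \<cdot> c j = x j)"
    using col by (simp add: colimit_def)
  moreover have "h \<cdot> c j = x j \<longleftrightarrow> flip (FObj D j) Z (h \<cdot> c j) = y j"
    if "j \<in> J" "h \<in> Hom C X (dual K Z)" for h j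
    using flip_inject[OF D(2)[OF that(1)] Z comp_hom[OF c[OF that(1)] that(2)] x(1)[OF that(1)]]
      x(2)[OF that(1)] by metis
  ultimately show ?thesis
    by (simp cong: conj_cong)
qed

end

section \<open>Extending duals along directed colimits\<close>

locale compactly_accessible_duals = smc_duals C K
  for C :: "('o, 'm, 'x) smcat_scheme" (structure) and K :: "('o, 'm) duals" +
  fixes U :: "'u set" and E M :: "'m set"
  assumes accessible: "compactly_accessible U C E M"
begin

lemma compactly_presentable_compact: "compactly_presentable U C M X \<Longrightarrow> compact_obj C X"
  by (simp add: compactly_presentable_def)

lemma directed_colimit:
  assumes "X \<in> Obj C"
  obtains J r D d where "directed_diagram U C J r D" "\<And>j. j \<in> J \<Longrightarrow> compactly_presentable U C M (FObj D j)"
    "colimit (poset_cat J r) C D X d"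
  using accessible assms unfolding compactly_accessible_def by metis

text \<open>Injections of a colimit are jointly epic, and every object is a colimit of objects that
  are in particular compact.\<close>

lemma compact_separating:
  assumes g: "g \<in> Hom C Y X" and g': "g' \<in> Hom C Y X"
    and eq: "\<And>Z h. compact_obj C Z \<Longrightarrow> h \<in> Hom C Z Y \<Longrightarrow> g \<cdot> h = g' \<cdot> h"
  shows "g = g'"
proof -
  have "Y \<in> Obj C" using g by (auto simp: in_Hom_iff)
  then obtain J r D d where D: "directed_diagram U C J r D"
    "\<And>j. j \<in> J \<Longrightarrow> compactly_presentable U C M (FObj D j)" "colimit (poset_cat J r) C D Y d"
    by (rule directed_colimit) blast
  show ?thesis
  proof (rule colimit_eqI[OF D(3) g g' _ D(1)])
    show "g \<cdot> d j = g' \<cdot> d j" if "j \<in> J" for j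
      using D(2)[OF that] D(3) that
      by (intro eq) (auto simp: colimit_def cocone_poset_iff compactly_presentable_compact)
  qed
qed

text \<open>Accessibility grants limits of codirected diagrams of compact objects. Contravariant
  functoriality of \<open>dual_arr\<close> makes the dual diagram one of these.\<close>

lemma dual_diagram_limit:
  assumes D: "directed_diagram U C J r D" "\<And>j. j \<in> J \<Longrightarrow> compact_obj C (FObj D j)"
  obtains X' p where "limit (op_cat (poset_cat J r)) C (dual_diagram C K D) X' p"
proof -
  have F: "is_functor (poset_cat J r) C D" using D(1) by (simp add: directed_diagram_def)
  have P: "category (poset_cat J r)" using F by (simp add: is_functor_def)
  have O: "i \<in> J" "j \<in> J" if "a \<in> Hom (poset_cat J r) i j" for a i j
    using that category.dom_closed[OF P, of a] category.cod_closed[OF P, of a] by (auto simp: Hom_def)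
  have "is_functor (op_cat (poset_cat J r)) C (dual_diagram C K D)"
    unfolding is_functor_def
  proof (intro conjI ballI allI)
    show "category (op_cat (poset_cat J r))" by (rule category.category_op[OF P])
    show "category C" by (rule category_axioms)
    show "FObj (dual_diagram C K D) j \<in> Obj C" if "j \<in> Obj (op_cat (poset_cat J r))" for j
      using that D(2) by simp
    show "FArr (dual_diagram C K D) a \<in> Hom C (FObj (dual_diagram C K D) i) (FObj (dual_diagram C K D) j)"
      if a: "a \<in> Hom (op_cat (poset_cat J r)) i j" for i j a
    proof -
      have "FArr D a \<in> Hom C (FObj D j) (FObj D i)"
        using a F by (simp add: is_functor_def Hom_op_cat)
      then show ?thesis
        using dual_arr(1)[OF D(2) D(2)] O a by (simp add: Hom_op_cat)
    qed
    show "FArr (dual_diagram C K D) (Ident (op_cat (poset_cat J r)) j) = Ident C (FObj (dual_diagram C K D) j)"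
      if "j \<in> Obj (op_cat (poset_cat J r))" for j
      using that F dual_arr_ident[OF D(2)] by (simp add: is_functor_def op_cat_def)
    show "FArr (dual_diagram C K D) (b \<cdot>\<^bsub>op_cat (poset_cat J r)\<^esub> a)
        = FArr (dual_diagram C K D) b \<cdot> FArr (dual_diagram C K D) a"
      if a: "a \<in> Hom (op_cat (poset_cat J r)) i j" and b: "b \<in> Hom (op_cat (poset_cat J r)) j k" for i j k a b
    proof -
      note a' = a[unfolded Hom_op_cat] and b' = b[unfolded Hom_op_cat]
      have "FArr D a \<in> Hom C (FObj D j) (FObj D i)" "FArr D b \<in> Hom C (FObj D k) (FObj D j)"
        using a b F by (simp_all add: is_functor_def Hom_op_cat)
      moreover have "FArr D (a \<cdot>\<^bsub>poset_cat J r\<^esub> b) = FArr D a \<cdot> FArr D b"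
        using a b F by (auto simp: is_functor_def Hom_op_cat)
      ultimately show ?thesis
        using O[OF a'] O[OF b'] dual_arr_comp[OF D(2) D(2) D(2), of k j i] by (simp add: Comp_op_cat)
    qed
  qed
  with D(1) have "codirected_diagram U C J r (dual_diagram C K D)"
    by (simp add: directed_diagram_def codirected_diagram_def)
  moreover have "\<forall>j\<in>J. compact_obj C (FObj (dual_diagram C K D) j)"
    using D(2) by simp
  ultimately show ?thesis
    using accessible that unfolding compactly_accessible_def by metis
qed

text \<open>For compact \<open>Z\<close>, arrows from \<open>Z\<close> to \<open>dual K X\<close>
  are by \<open>flip\<close> arrows from \<open>X\<close> to \<open>dual K Z\<close>, hence cocones
  over \<open>D\<close>, hence compatible families into the duals. A general source \<open>W\<close>
  is then treated by gluing over a presentation of \<open>W\<close> by compact objects.\<close>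

lemma compact_dual_limit:
  assumes D: "directed_diagram U C J r D" "\<And>j. j \<in> J \<Longrightarrow> compact_obj C (FObj D j)"
    and col: "colimit (poset_cat J r) C D X c" and X: "compact_obj C X"
  shows "limit (op_cat (poset_cat J r)) C (dual_diagram C K D) (dual K X) (\<lambda>j. dual_arr C K (c j))"
  unfolding limit_def
proof (intro conjI allI impI)
  have c: "c j \<in> Hom C (FObj D j) X" if "j \<in> J" for j
    using col that by (simp add: colimit_def cocone_poset_iff)
  have c_le: "c j \<cdot> FArr D (i, j) = c i" if "(i, j) \<in> r" for i j
    using col that by (simp add: colimit_def cocone_poset_iff)
  have c': "dual_arr C K (c j) \<in> Hom C (dual K X) (dual K (FObj D j))" if "j \<in> J" for j
    by (rule dual_arr[OF D(2)[OF that] X c[OF that]])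
  have c'_le: "dual_arr C K (FArr D (i, j)) \<cdot> dual_arr C K (c j) = dual_arr C K (c i)" if "(i, j) \<in> r" for i j
    using dual_arr_comp[OF D(2) D(2) X _ c] directed_diagram_le[OF D(1) that] c_le[OF that] by metis
  show "cone (op_cat (poset_cat J r)) C (dual_diagram C K D) (dual K X) (\<lambda>j. dual_arr C K (c j))"
    using X c' c'_le by (simp add: cone_poset_iff)
  fix W q assume "cone (op_cat (poset_cat J r)) C (dual_diagram C K D) W q"
  then have W: "W \<in> Obj C" and q: "\<And>j. j \<in> J \<Longrightarrow> q j \<in> Hom C W (dual K (FObj D j))"
    and q_le: "\<And>i j. (i, j) \<in> r \<Longrightarrow> dual_arr C K (FArr D (i, j)) \<cdot> q j = q i"
    by (simp_all add: cone_poset_iff)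
  have D': "dual_arr C K (FArr D (i, j)) \<in> Hom C (dual K (FObj D j)) (dual K (FObj D i))" if "(i, j) \<in> r" for i j
    using dual_arr(1)[OF D(2) D(2)] directed_diagram_le[OF D(1) that] by blast
  have compact_case: "\<exists>!h. h \<in> Hom C Z (dual K X) \<and> (\<forall>j\<in>J. dual_arr C K (c j) \<cdot> h = q j \<cdot> z)"
    if Z: "compact_obj C Z" and z: "z \<in> Hom C Z W" for Z z
  proof -
    have *: "\<exists>!x. x \<in> Hom C X (dual K Z) \<and> (\<forall>j\<in>J. flip (FObj D j) Z (x \<cdot> c j) = q j \<cdot> z)"
    proof (rule flip_colimit[OF D col Z])
      show "q j \<cdot> z \<in> Hom C Z (dual K (FObj D j))" if "j \<in> J" for j
        by (rule comp_hom[OF z q[OF that]])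
      show "dual_arr C K (FArr D (i, j)) \<cdot> q j \<cdot> z = q i \<cdot> z" if "(i, j) \<in> r" for i j
        using comp_assoc[OF z q D'[OF that]] directed_diagram_le[OF D(1) that] q_le[OF that] by metis
    qed
    \<comment> \<open>Here \<open>X\<close> is compact, so \<open>flip\<close> is available at
      \<open>X\<close> as well and is natural along \<open>c j\<close>.\<close>
    have fl: "dual_arr C K (c j) \<cdot> flip X Z x = flip (FObj D j) Z (x \<cdot> c j)"
      if "j \<in> J" "x \<in> Hom C X (dual K Z)" for j x
      by (rule flip_comp[OF D(2)[OF that(1)] X Z c[OF that(1)] that(2), symmetric])
    from * obtain x where x: "x \<in> Hom C X (dual K Z)" "\<forall>j\<in>J. flip (FObj D j) Z (x \<cdot> c j) = q j \<cdot> z"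
      by blast
    show ?thesis
    proof (rule ex1I[of _ "flip X Z x"])
      show "flip X Z x \<in> Hom C Z (dual K X) \<and> (\<forall>j\<in>J. dual_arr C K (c j) \<cdot> flip X Z x = q j \<cdot> z)"
        using flip(1)[OF X Z x(1)] fl x by simp
      fix h assume h: "h \<in> Hom C Z (dual K X) \<and> (\<forall>j\<in>J. dual_arr C K (c j) \<cdot> h = q j \<cdot> z)"
      then obtain x' where "x' \<in> Hom C X (dual K Z)" "flip X Z x' = h"
        using flip_ex1[OF X Z, of h] by blast
      with h * x fl show "h = flip X Z x" by metis
    qed
  qed
  obtain J' r' B w where B: "directed_diagram U C J' r' B"
    "\<And>j. j \<in> J' \<Longrightarrow> compactly_presentable U C M (FObj B j)" "colimit (poset_cat J' r') C B W w"
    using directed_colimit[OF W] by metis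
  have Bc: "compact_obj C (FObj B k)" if "k \<in> J'" for k
    using B(2)[OF that] by (rule compactly_presentable_compact)
  have w: "w k \<in> Hom C (FObj B k) W" if "k \<in> J'" for k
    using B(3) that by (simp add: colimit_def cocone_poset_iff)
  have w_le: "w k' \<cdot> FArr B (k, k') = w k" if "(k, k') \<in> r'" for k k'
    using B(3) that by (simp add: colimit_def cocone_poset_iff)
  \<comment> \<open>The mediating arrow is built piecewise: \<open>t k\<close> mediates for the cone
    restricted along \<open>w k\<close>. Uniqueness in \<open>compact_case\<close> makes the pieces
    compatible.\<close>
  obtain t where t: "\<And>k. k \<in> J' \<Longrightarrow> t k \<in> Hom C (FObj B k) (dual K X)"
      "\<And>k j. k \<in> J' \<Longrightarrow> j \<in> J \<Longrightarrow> dual_arr C K (c j) \<cdot> t k = q j \<cdot> w k"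
    using compact_case[OF Bc w] by metis
  have "cocone (poset_cat J' r') C B (dual K X) t"
    unfolding cocone_poset_iff
  proof (intro conjI allI impI ballI)
    fix k k' assume le: "(k, k') \<in> r'"
    note kk = directed_diagram_le[OF B(1) le]
    have h: "t k' \<cdot> FArr B (k, k') \<in> Hom C (FObj B k) (dual K X)"
      by (rule comp_hom[OF kk(3) t(1)[OF kk(2)]])
    moreover have "dual_arr C K (c j) \<cdot> t k' \<cdot> FArr B (k, k') = q j \<cdot> w k" if "j \<in> J" for j
      using comp_assoc[OF kk(3) t(1)[OF kk(2)] c'[OF that]] t(2)[OF kk(2) that]
        comp_assoc[OF kk(3) w[OF kk(2)] q[OF that]] w_le[OF le] by simp
    ultimately show "t k' \<cdot> FArr B (k, k') = t k"
      using compact_case[OF Bc w, OF kk(1) kk(1)] t(1)[OF kk(1)] t(2)[OF kk(1)] by blast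
  qed (use t X in auto)
  then have "\<exists>!h. h \<in> Hom C W (dual K X) \<and> (\<forall>k\<in>J'. h \<cdot> w k = t k)"
    using B(3) by (simp add: colimit_def)
  then obtain h where h: "h \<in> Hom C W (dual K X)" "\<And>k. k \<in> J' \<Longrightarrow> h \<cdot> w k = t k"
    by blast
  show "\<exists>!h. h \<in> Hom C W (dual K X) \<and>
      (\<forall>j\<in>Obj (op_cat (poset_cat J r)). dual_arr C K (c j) \<cdot> h = q j)"
  proof (rule ex1I[of _ h])
    \<comment> \<open>Equality of arrows out of \<open>W\<close> is checked after composing with
      each \<open>w k\<close>, where it is the defining property of \<open>t k\<close>.\<close>
    have "dual_arr C K (c j) \<cdot> h = q j" if "j \<in> J" for j
    proof (rule colimit_eqI[OF B(3) comp_hom[OF h(1) c'[OF that]] q[OF that] _ B(1)])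
      show "(dual_arr C K (c j) \<cdot> h) \<cdot> w k = q j \<cdot> w k" if "k \<in> J'" for k
        using comp_assoc[OF w[OF that] h(1) c'[OF \<open>j \<in> J\<close>]] h(2)[OF that] t(2)[OF that \<open>j \<in> J\<close>] by simp
    qed
    with h(1) show "h \<in> Hom C W (dual K X) \<and> (\<forall>j\<in>Obj (op_cat (poset_cat J r)). dual_arr C K (c j) \<cdot> h = q j)"
      by simp
    fix h' assume h': "h' \<in> Hom C W (dual K X) \<and> (\<forall>j\<in>Obj (op_cat (poset_cat J r)). dual_arr C K (c j) \<cdot> h' = q j)"
    show "h' = h"
    proof (rule colimit_eqI[OF B(3) _ h(1) _ B(1)])
      show "h' \<in> Hom C W (dual K X)" using h' by simp
      fix k assume k: "k \<in> J'"
      have "h' \<cdot> w k \<in> Hom C (FObj B k) (dual K X)"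
        using h' by (intro comp_hom[OF w[OF k]]) simp
      moreover have "dual_arr C K (c j) \<cdot> h' \<cdot> w k = q j \<cdot> w k" if "j \<in> J" for j
        using comp_assoc[OF w[OF k] _ c'[OF that], of h'] h' that by simp
      ultimately show "h' \<cdot> w k = h \<cdot> w k"
        using compact_case[OF Bc w, OF k k] t(1)[OF k] t(2)[OF k] h(2)[OF k] by metis
    qed
  qed
qed


section \<open>Presentations of arbitrary objects and the induced correspondence of arrows\<close>

lemma dual_presentationD:
  assumes S: "dual_presentation U C M K X X' S"
  shows "X \<in> Obj C" "X' \<in> Obj C" "directed_diagram U C (Idx S) (Le S) (Dgm S)"
    "i \<in> Idx S \<Longrightarrow> compactly_presentable U C M (FObj (Dgm S) i)"
    "i \<in> Idx S \<Longrightarrow> compact_obj C (FObj (Dgm S) i)"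
    "colimit (Shape S) C (Dgm S) X (Inj S)"
    "i \<in> Idx S \<Longrightarrow> Inj S i \<in> Hom C (FObj (Dgm S) i) X"
    "(i, j) \<in> Le S \<Longrightarrow> Inj S j \<cdot> FArr (Dgm S) (i, j) = Inj S i"
    "limit (op_cat (Shape S)) C (dual_diagram C K (Dgm S)) X' (Proj S)"
    "i \<in> Idx S \<Longrightarrow> Proj S i \<in> Hom C X' (dual K (FObj (Dgm S) i))"
    "(i, j) \<in> Le S \<Longrightarrow> dual_arr C K (FArr (Dgm S) (i, j)) \<cdot> Proj S j = Proj S i"
  using assms
  by (auto simp: dual_presentation_def colimit_def limit_def cocone_poset_iff cone_poset_iff
      compactly_presentable_compact)

lemma dual_arr_le:
  assumes S: "dual_presentation U C M K X X' S" and le: "(i, j) \<in> Le S"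
  shows "dual_arr C K (FArr (Dgm S) (i, j)) \<in> Hom C (dual K (FObj (Dgm S) j)) (dual K (FObj (Dgm S) i))"
  using dual_presentationD(3,5)[OF S] le by (meson dual_arr(1) directed_diagram_le)

lemma limit_eqI:
  assumes S: "dual_presentation U C M K X X' S" and h: "h \<in> Hom C Z X'" "h' \<in> Hom C Z X'"
    and eq: "\<And>i. i \<in> Idx S \<Longrightarrow> Proj S i \<cdot> h = Proj S i \<cdot> h'"
  shows "h = h'"
proof -
  note S' = dual_presentationD[OF S]
  have "cone (op_cat (Shape S)) C (dual_diagram C K (Dgm S)) Z (\<lambda>i. Proj S i \<cdot> h)"
    unfolding cone_poset_iff
  proof (intro conjI allI impI ballI)
    show "Z \<in> Obj C" using h(1) by (auto simp: in_Hom_iff)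
    show "Proj S i \<cdot> h \<in> Hom C Z (FObj (dual_diagram C K (Dgm S)) i)" if "i \<in> Idx S" for i
      using comp_hom[OF h(1) S'(10)[OF that]] by simp
    show "FArr (dual_diagram C K (Dgm S)) (i, j) \<cdot> Proj S j \<cdot> h = Proj S i \<cdot> h" if "(i, j) \<in> Le S" for i j
      using comp_assoc[OF h(1) S'(10) dual_arr_le[OF S that]] S'(11)[OF that] directed_diagram_le[OF S'(3) that]
      by simp
  qed
  then have "\<exists>!g. g \<in> Hom C Z X' \<and> (\<forall>i\<in>Idx S. Proj S i \<cdot> g = Proj S i \<cdot> h)"
    using S'(9) by (simp add: limit_def)
  with h eq show ?thesis by metis
qed

text \<open>A limit is determined only up to isomorphism. For compact \<open>X\<close> the chosen
  dual is taken as the limit, with the duals of the injections as projections, so that the functor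
  will agree with the choice of duals exactly.\<close>

lemma dual_presentation_exists:
  assumes "X \<in> Obj C"
  obtains X' S where "dual_presentation U C M K X X' S"
    "compact_obj C X \<Longrightarrow> X' = dual K X \<and> Proj S = (\<lambda>i. dual_arr C K (Inj S i))"
proof -
  obtain J r D d where D: "directed_diagram U C J r D"
    "\<And>j. j \<in> J \<Longrightarrow> compactly_presentable U C M (FObj D j)" "colimit (poset_cat J r) C D X d"
    using directed_colimit[OF assms] by metis
  have Dc: "compact_obj C (FObj D j)" if "j \<in> J" for j
    using D(2)[OF that] by (rule compactly_presentable_compact)
  show ?thesis
  proof (cases "compact_obj C X")
    case True
    then show ?thesis
      using D compact_dual_limit[OF D(1) Dc D(3)]
      by (intro that[of "dual K X" "\<lparr>Idx = J, Le = r, Dgm = D, Inj = d, Proj = \<lambda>i. dual_arr C K (d i)\<rparr>"])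
        (auto simp: dual_presentation_def)
  next
    case False
    obtain X' p where "limit (op_cat (poset_cat J r)) C (dual_diagram C K D) X' p"
      using dual_diagram_limit[OF D(1) Dc] by metis
    with False D show ?thesis
      by (intro that[of X' "\<lparr>Idx = J, Le = r, Dgm = D, Inj = d, Proj = p\<rparr>"])
        (auto simp: dual_presentation_def)
  qed
qed

text \<open>\<open>k : X \<rightarrow> Z\<^sup>*\<close> and \<open>h : Z \<rightarrow> X\<^sup>*\<close> correspond under \<open>Hom(X, Z\<^sup>*) \<cong> Hom(Z, X\<^sup>*)\<close>.\<close>

definition matches :: "('u, 'o, 'm) presentation \<Rightarrow> 'o \<Rightarrow> 'm \<Rightarrow> 'm \<Rightarrow> bool" where
  "matches S Z k h \<longleftrightarrow> (\<forall>i\<in>Idx S. Proj S i \<cdot> h = flip (FObj (Dgm S) i) Z (k \<cdot> Inj S i))"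

text \<open>Composing \<open>h\<close> with the limit projections gives a compatible family, and
  \<open>flip_colimit\<close> turns it into \<open>k\<close>.\<close>

lemma matches_exists:
  assumes S: "dual_presentation U C M K X X' S" and Z: "compact_obj C Z" and h: "h \<in> Hom C Z X'"
  obtains k where "k \<in> Hom C X (dual K Z)" "matches S Z k h"
proof -
  note S' = dual_presentationD[OF S]
  have "\<exists>!k. k \<in> Hom C X (dual K Z) \<and>
      (\<forall>i\<in>Idx S. flip (FObj (Dgm S) i) Z (k \<cdot> Inj S i) = Proj S i \<cdot> h)"
  proof (rule flip_colimit[OF S'(3,5,6) Z])
    show "Proj S i \<cdot> h \<in> Hom C Z (dual K (FObj (Dgm S) i))" if "i \<in> Idx S" for i
      by (rule comp_hom[OF h S'(10)[OF that]])
    show "dual_arr C K (FArr (Dgm S) (i, j)) \<cdot> Proj S j \<cdot> h = Proj S i \<cdot> h" if "(i, j) \<in> Le S" for i j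
      using comp_assoc[OF h S'(10) dual_arr_le[OF S that]] S'(11)[OF that] directed_diagram_le[OF S'(3) that]
      by simp
  qed
  then show ?thesis using that by (metis matches_def)
qed

section \<open>The cone of the dual-morphism construction\<close>

lemma factorisation_data_exists:
  assumes S: "dual_presentation U C M K X X' S" and T: "dual_presentation U C M K Y Y' T"
    and f: "f \<in> Hom C X Y"
  shows "\<exists>fs ms js ns. factorisation_data C E M S T f fs ms js ns"
proof -
  note S' = dual_presentationD[OF S] and T' = dual_presentationD[OF T]
  have wfs: "weak_factorisation_system C E M"
    and E: "\<And>e. e \<in> E \<Longrightarrow> compactly_presentable U C M (Dom C e) \<Longrightarrow> compactly_presentable U C M (Cod C e)"
    using accessible by (auto simp: compactly_accessible_def compactly_presentable_wfs_def)
  have "\<exists>e m j n. e \<in> E \<and> Dom C e = FObj (Dgm S) i \<and> m \<in> M \<inter> Hom C (Cod C e) (Cod C f) \<and>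
      f \<cdot> Inj S i = m \<cdot> e \<and> j \<in> Idx T \<and> n \<in> M \<inter> Hom C (Cod C e) (FObj (Dgm T) j) \<and> m = Inj T j \<cdot> n"
    if i: "i \<in> Idx S" for i
  proof -
    have fc: "f \<cdot> Inj S i \<in> Hom C (FObj (Dgm S) i) Y"
      by (rule comp_hom[OF S'(7)[OF i] f])
    then obtain e m where em: "e \<in> E" "m \<in> M" "Cod C e = Dom C m" "f \<cdot> Inj S i = m \<cdot> e"
      using wfs by (auto simp: weak_factorisation_system_def in_Hom_iff)
    have arr: "e \<in> Arr C" "m \<in> Arr C"
      using em wfs by (auto simp: weak_factorisation_system_def)
    have dom: "Dom C e = FObj (Dgm S) i" and cod: "Cod C m = Y"
      using fc em arr by (auto simp: in_Hom_iff)
    \<comment> \<open>Arrows in \<open>E\<close> preserve compact presentability, so the middle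
      object inherits it from the diagram object; its presentability then lets \<open>m\<close>
      factor through a stage of \<open>T\<close>.\<close>
    have "compactly_presentable U C M (Cod C e)"
      using E[OF em(1)] S'(4)[OF i] dom by simp
    moreover have m: "m \<in> M \<inter> Hom C (Cod C e) Y"
      using em arr cod by (simp add: in_Hom_iff)
    ultimately obtain j n where "j \<in> Idx T" "n \<in> M \<inter> Hom C (Cod C e) (FObj (Dgm T) j)" "m = Inj T j \<cdot> n"
      using T'(3,5,6) unfolding compactly_presentable_def by meson
    with em(1,4) dom m f show ?thesis by (auto simp: in_Hom_iff)
  qed
  then show ?thesis
    unfolding factorisation_data_def by (simp only: bchoice_iff[symmetric] Ball_def) metis
qed

text \<open>Naturality of \<open>flip\<close> along \<open>ns i\<close> and then \<open>fs i\<close>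
  collects \<open>Inj T (js i) \<cdot> ns i \<cdot> fs i\<close> under \<open>flip\<close>. This is
  \<open>f \<cdot> Inj S i\<close>, so the chosen factorisation leaves no trace.\<close>

lemma constructed_leg:
  assumes S: "dual_presentation U C M K X X' S" and T: "dual_presentation U C M K Y Y' T"
    and f: "f \<in> Hom C X Y" and fd: "factorisation_data C E M S T f fs ms js ns" and i: "i \<in> Idx S"
  defines "q \<equiv> dual_arr C K (fs i) \<cdot> dual_arr C K (ns i) \<cdot> Proj T (js i)"
  shows "q \<in> Hom C Y' (dual K (FObj (Dgm S) i))"
    "\<And>Z k h. compact_obj C Z \<Longrightarrow> k \<in> Hom C Y (dual K Z) \<Longrightarrow> h \<in> Hom C Z Y' \<Longrightarrow> matches T Z k h \<Longrightarrow>
       q \<cdot> h = flip (FObj (Dgm S) i) Z ((k \<cdot> f) \<cdot> Inj S i)"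
proof -
  note S' = dual_presentationD[OF S] and T' = dual_presentationD[OF T]
  let ?A = "FObj (Dgm S) i" and ?V = "Cod C (fs i)" and ?B = "FObj (Dgm T) (js i)"
  have e: "fs i \<in> E" "Dom C (fs i) = ?A" and m: "ms i \<in> Hom C ?V Y" "f \<cdot> Inj S i = ms i \<cdot> fs i"
    and j: "js i \<in> Idx T" and n: "ns i \<in> Hom C ?V ?B" "ms i = Inj T (js i) \<cdot> ns i"
    using fd i f by (auto simp: factorisation_data_def in_Hom_iff)
  have c: "compact_obj C ?A" "compact_obj C ?B" by (rule S'(5)[OF i]) (rule T'(5)[OF j])
  \<comment> \<open>The middle object must be compact for the duals of \<open>fs i\<close> and
    \<open>ns i\<close> to be governed by \<open>dual_arr\<close> and
    \<open>flip_comp\<close>.\<close>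
  have "E \<subseteq> Arr C" and "compactly_presentable U C M ?V"
    using accessible e S'(4)[OF i]
    by (auto simp: compactly_accessible_def compactly_presentable_wfs_def weak_factorisation_system_def)
  then have V: "compact_obj C ?V" and e': "fs i \<in> Hom C ?A ?V"
    using e by (auto simp: compactly_presentable_compact in_Hom_iff)
  note de = dual_arr(1)[OF c(1) V e'] and dn = dual_arr(1)[OF V c(2) n(1)] and p = T'(10)[OF j]
  note [simp] = de[unfolded in_Hom_iff] dn[unfolded in_Hom_iff] p[unfolded in_Hom_iff]
    e'[unfolded in_Hom_iff, THEN conjunct1] e(2) n(1)[unfolded in_Hom_iff] f[unfolded in_Hom_iff] S'(7)[OF i, unfolded in_Hom_iff]
    T'(7)[OF j, unfolded in_Hom_iff]
  show "q \<in> Hom C Y' (dual K ?A)"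
    unfolding q_def by (rule comp_hom[OF comp_hom[OF p dn] de])
  fix Z k h assume Z: "compact_obj C Z" and k: "k \<in> Hom C Y (dual K Z)" and h: "h \<in> Hom C Z Y'"
    and kh: "matches T Z k h"
  note [simp] = k[unfolded in_Hom_iff] h[unfolded in_Hom_iff]
  have kd: "k \<cdot> Inj T (js i) \<in> Hom C ?B (dual K Z)" by (simp add: in_Hom_iff)
  have kdn: "(k \<cdot> Inj T (js i)) \<cdot> ns i \<in> Hom C ?V (dual K Z)" by (simp add: in_Hom_iff)
  have "q \<cdot> h = dual_arr C K (fs i) \<cdot> dual_arr C K (ns i) \<cdot> (Proj T (js i) \<cdot> h)"
    by (simp add: q_def)
  also have "Proj T (js i) \<cdot> h = flip ?B Z (k \<cdot> Inj T (js i))"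
    using kh j by (simp add: matches_def)
  also have "dual_arr C K (ns i) \<cdot> flip ?B Z (k \<cdot> Inj T (js i)) = flip ?V Z ((k \<cdot> Inj T (js i)) \<cdot> ns i)"
    by (rule flip_comp[OF V c(2) Z n(1) kd, symmetric])
  also have "dual_arr C K (fs i) \<cdot> flip ?V Z ((k \<cdot> Inj T (js i)) \<cdot> ns i)
      = flip ?A Z (((k \<cdot> Inj T (js i)) \<cdot> ns i) \<cdot> fs i)"
    by (rule flip_comp[OF c(1) V Z e' kdn, symmetric])
  also have "((k \<cdot> Inj T (js i)) \<cdot> ns i) \<cdot> fs i = k \<cdot> (ms i \<cdot> fs i)"
    unfolding n(2) by simp
  also have "\<dots> = (k \<cdot> f) \<cdot> Inj S i"
    unfolding m(2)[symmetric] by simp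
  finally show "q \<cdot> h = flip ?A Z ((k \<cdot> f) \<cdot> Inj S i)" .
qed

text \<open>Composed with an arrow from a compact \<open>Z\<close>, both sides of the cone equation
  become the flip of \<open>(k \<cdot> f) \<cdot> Inj S i\<close>, because the injections of
  \<open>S\<close> form a cocone. The legs at \<open>i\<close> and \<open>j\<close> may come from
  unrelated factorisations.\<close>

lemma constructed_cone:
  assumes S: "dual_presentation U C M K X X' S" and T: "dual_presentation U C M K Y Y' T"
    and f: "f \<in> Hom C X Y" and fd: "factorisation_data C E M S T f fs ms js ns"
  shows "cone (op_cat (Shape S)) C (dual_diagram C K (Dgm S)) Y'
     (\<lambda>i. dual_arr C K (fs i) \<cdot> dual_arr C K (ns i) \<cdot> Proj T (js i))" (is "cone _ _ _ _ ?q")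
  unfolding cone_poset_iff
proof (intro conjI ballI allI impI)
  note S' = dual_presentationD[OF S] and T' = dual_presentationD[OF T]
  show "Y' \<in> Obj C" by (rule T')
  show "?q i \<in> Hom C Y' (FObj (dual_diagram C K (Dgm S)) i)" if "i \<in> Idx S" for i
    using constructed_leg(1)[OF S T f fd that] by simp
  fix i j assume le: "(i, j) \<in> Le S"
  note ij = directed_diagram_le[OF S'(3) le] and d = dual_arr_le[OF S le]
  note q = constructed_leg[OF S T f fd ij(1)] constructed_leg[OF S T f fd ij(2)]
  have "dual_arr C K (FArr (Dgm S) (i, j)) \<cdot> ?q j = ?q i"
  proof (rule compact_separating[OF comp_hom[OF q(3) d] q(1)])
    fix Z h assume Z: "compact_obj C Z" and h: "h \<in> Hom C Z Y'"
    obtain k where k: "k \<in> Hom C Y (dual K Z)" "matches T Z k h"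
      using matches_exists[OF T Z h] by metis
    have kf: "k \<cdot> f \<in> Hom C X (dual K Z)" by (rule comp_hom[OF f k(1)])
    have "(dual_arr C K (FArr (Dgm S) (i, j)) \<cdot> ?q j) \<cdot> h
        = dual_arr C K (FArr (Dgm S) (i, j)) \<cdot> flip (FObj (Dgm S) j) Z ((k \<cdot> f) \<cdot> Inj S j)"
      using comp_assoc[OF h q(3) d] q(4)[OF Z k(1) h k(2)] by simp
    also have "\<dots> = flip (FObj (Dgm S) i) Z (((k \<cdot> f) \<cdot> Inj S j) \<cdot> FArr (Dgm S) (i, j))"
      by (rule flip_comp[OF S'(5)[OF ij(1)] S'(5)[OF ij(2)] Z ij(3) comp_hom[OF S'(7)[OF ij(2)] kf], symmetric])
    also have "((k \<cdot> f) \<cdot> Inj S j) \<cdot> FArr (Dgm S) (i, j) = (k \<cdot> f) \<cdot> Inj S i"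
      using comp_assoc[OF ij(3) S'(7)[OF ij(2)] kf] S'(8)[OF le] by simp
    also have "flip (FObj (Dgm S) i) Z ((k \<cdot> f) \<cdot> Inj S i) = ?q i \<cdot> h"
      by (rule q(2)[OF Z k(1) h k(2), symmetric])
    finally show "(dual_arr C K (FArr (Dgm S) (i, j)) \<cdot> ?q j) \<cdot> h = ?q i \<cdot> h" .
  qed
  then show "FArr (dual_diagram C K (Dgm S)) (i, j) \<cdot> ?q j = ?q i" by simp
qed

section \<open>Dual morphisms described without factorisations\<close>

text \<open>\<open>g : Y\<^sup>* \<rightarrow> X\<^sup>*\<close> acts as precomposition with \<open>f\<close>; this determines \<open>g\<close> without reference to
  factorisations.\<close>

definition extends :: "('u, 'o, 'm) presentation \<Rightarrow> ('u, 'o, 'm) presentation \<Rightarrow> 'o \<Rightarrow> 'o \<Rightarrow> 'm \<Rightarrow> 'm \<Rightarrow> bool" where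
  "extends S T X' Y' f g \<longleftrightarrow> g \<in> Hom C Y' X' \<and>
     (\<forall>Z k h. compact_obj C Z \<longrightarrow> k \<in> Hom C (Cod C f) (dual K Z) \<longrightarrow> h \<in> Hom C Z Y' \<longrightarrow>
        matches T Z k h \<longrightarrow> matches S Z (k \<cdot> f) (g \<cdot> h))"

text \<open>Given \<open>h\<close> from a compact object, any matching \<open>k\<close> fixes the
  composites of \<open>g \<cdot> h\<close> with all projections of \<open>S\<close>, and these are
  jointly monic.\<close>

lemma extends_unique:
  assumes S: "dual_presentation U C M K X X' S" and T: "dual_presentation U C M K Y Y' T"
    and f: "f \<in> Hom C X Y" and g: "extends S T X' Y' f g" "extends S T X' Y' f g'"
  shows "g = g'"
proof (rule compact_separating)
  show gg: "g \<in> Hom C Y' X'" "g' \<in> Hom C Y' X'" using g by (auto simp: extends_def)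
  fix Z h assume Z: "compact_obj C Z" and h: "h \<in> Hom C Z Y'"
  obtain k where k: "k \<in> Hom C Y (dual K Z)" "matches T Z k h"
    using matches_exists[OF T Z h] by metis
  have "matches S Z (k \<cdot> f) (g \<cdot> h)" "matches S Z (k \<cdot> f) (g' \<cdot> h)"
    using g f Z h k by (auto simp: extends_def in_Hom_iff)
  then show "g \<cdot> h = g' \<cdot> h"
    by (intro limit_eqI[OF S comp_hom[OF h gg(1)] comp_hom[OF h gg(2)]]) (simp add: matches_def)
qed

text \<open>This links the two descriptions of the dual morphism. The left side does not mention the
  factorisations, so every choice of them has the same mediating arrow.\<close>

lemma extends_iff:
  assumes S: "dual_presentation U C M K X X' S" and T: "dual_presentation U C M K Y Y' T"
    and f: "f \<in> Hom C X Y" and fd: "factorisation_data C E M S T f fs ms js ns" and g: "g \<in> Hom C Y' X'"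
  shows "extends S T X' Y' f g \<longleftrightarrow>
    (\<forall>i\<in>Idx S. Proj S i \<cdot> g = dual_arr C K (fs i) \<cdot> dual_arr C K (ns i) \<cdot> Proj T (js i))"
proof -
  note S' = dual_presentationD[OF S] and q = constructed_leg[OF S T f fd]
  have pg: "Proj S i \<cdot> g \<cdot> h = (Proj S i \<cdot> g) \<cdot> h" if "i \<in> Idx S" "h \<in> Hom C Z Y'" for i Z h
    by (rule comp_assoc[OF that(2) g S'(10)[OF that(1)], symmetric])
  show ?thesis
  proof
    assume ext: "extends S T X' Y' f g"
    show "\<forall>i\<in>Idx S. Proj S i \<cdot> g = dual_arr C K (fs i) \<cdot> dual_arr C K (ns i) \<cdot> Proj T (js i)"
    proof
      fix i assume i: "i \<in> Idx S"
      show "Proj S i \<cdot> g = dual_arr C K (fs i) \<cdot> dual_arr C K (ns i) \<cdot> Proj T (js i)"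
      proof (rule compact_separating[OF comp_hom[OF g S'(10)[OF i]] q(1)[OF i]])
        fix Z h assume Z: "compact_obj C Z" and h: "h \<in> Hom C Z Y'"
        obtain k where k: "k \<in> Hom C Y (dual K Z)" "matches T Z k h"
          using matches_exists[OF T Z h] by metis
        then have "matches S Z (k \<cdot> f) (g \<cdot> h)"
          using ext f Z h by (simp add: extends_def in_Hom_iff)
        then show "(Proj S i \<cdot> g) \<cdot> h = (dual_arr C K (fs i) \<cdot> dual_arr C K (ns i) \<cdot> Proj T (js i)) \<cdot> h"
          using pg[OF i h] q(2)[OF i Z k(1) h k(2)] i by (simp add: matches_def del: assoc_comp)
      qed
    qed
  next
    assume eq: "\<forall>i\<in>Idx S. Proj S i \<cdot> g = dual_arr C K (fs i) \<cdot> dual_arr C K (ns i) \<cdot> Proj T (js i)"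
    show "extends S T X' Y' f g"
      unfolding extends_def matches_def[of S]
    proof (intro conjI allI impI ballI)
      fix Z k h i
      assume "compact_obj C Z" "k \<in> Hom C (Cod C f) (dual K Z)" "h \<in> Hom C Z Y'" "matches T Z k h" "i \<in> Idx S"
      then show "Proj S i \<cdot> g \<cdot> h = flip (FObj (Dgm S) i) Z ((k \<cdot> f) \<cdot> Inj S i)"
        using q(2)[of i Z k h] eq f pg[of i h Z] by (simp add: in_Hom_iff[of f] del: assoc_comp)
    qed (rule g)
  qed
qed

text \<open>Any one choice of factorisations yields a witness, namely the mediating arrow of its
  cone.\<close>

lemma extends_exists:
  assumes S: "dual_presentation U C M K X X' S" and T: "dual_presentation U C M K Y Y' T"
    and f: "f \<in> Hom C X Y"
  shows "\<exists>g. extends S T X' Y' f g"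
proof -
  obtain fs ms js ns where fd: "factorisation_data C E M S T f fs ms js ns"
    using factorisation_data_exists[OF S T f] by blast
  have "\<exists>!g. g \<in> Hom C Y' X' \<and>
      (\<forall>i\<in>Idx S. Proj S i \<cdot> g = dual_arr C K (fs i) \<cdot> dual_arr C K (ns i) \<cdot> Proj T (js i))"
    using constructed_cone[OF S T f fd] dual_presentationD(9)[OF S] by (simp add: limit_def)
  then show ?thesis using extends_iff[OF S T f fd] by blast
qed

lemma extends_constructed:
  assumes S: "dual_presentation U C M K X X' S" and T: "dual_presentation U C M K Y Y' T"
    and f: "f \<in> Hom C X Y" and g: "extends S T X' Y' f g"
  shows "constructed_dual_arr C E M K S T X' Y' f g"
  unfolding constructed_dual_arr_def Let_def
proof (intro conjI allI impI)
  show "\<exists>fs ms js ns. factorisation_data C E M S T f fs ms js ns"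
    by (rule factorisation_data_exists[OF S T f])
  fix fs ms js ns assume fd: "factorisation_data C E M S T f fs ms js ns"
  show "cone (op_cat (Shape S)) C (dual_diagram C K (Dgm S)) Y'
      (\<lambda>i. dual_arr C K (fs i) \<cdot> dual_arr C K (ns i) \<cdot> Proj T (js i))"
    by (rule constructed_cone[OF S T f fd])
  show "mediates_uniquely (op_cat (Shape S)) C X' (Proj S) Y'
      (\<lambda>i. dual_arr C K (fs i) \<cdot> dual_arr C K (ns i) \<cdot> Proj T (js i)) g"
    unfolding mediates_uniquely_def Obj_poset_cat
  proof (intro conjI ballI impI)
    show g_hom: "g \<in> Hom C Y' X'" using g by (simp add: extends_def)
    show "Proj S i \<cdot> g = dual_arr C K (fs i) \<cdot> dual_arr C K (ns i) \<cdot> Proj T (js i)" if "i \<in> Idx S" for i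
      using extends_iff[OF S T f fd g_hom] g that by blast
    show "h = g" if "h \<in> Hom C Y' X'"
      "\<forall>i\<in>Idx S. Proj S i \<cdot> h = dual_arr C K (fs i) \<cdot> dual_arr C K (ns i) \<cdot> Proj T (js i)" for h
      using extends_iff[OF S T f fd that(1)] that(2) extends_unique[OF S T f _ g] by blast
  qed
qed

lemma extends_ident:
  assumes S: "dual_presentation U C M K X X' S"
  shows "extends S S X' X' (Ident C X) (Ident C X')"
  using dual_presentationD(1,2)[OF S] by (auto simp: extends_def in_Hom_iff)

text \<open>Matching is passed along in two stages: first from \<open>T\<close> to \<open>S\<close>
  by precomposing with \<open>g\<close>, then from \<open>S\<close> to \<open>R\<close> by
  precomposing with \<open>f\<close>.\<close>

lemma extends_comp:
  assumes f: "f \<in> Hom C X Y" and g: "g \<in> Hom C Y Z"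
    and f': "extends R S X' Y' f f'" and g': "extends S T Y' Z' g g'"
  shows "extends R T X' Z' (g \<cdot> f) (f' \<cdot> g')"
proof -
  have fg: "f' \<in> Hom C Y' X'" "g' \<in> Hom C Z' Y'"
    using f' g' by (auto simp: extends_def)
  have "matches R V (k \<cdot> g \<cdot> f) ((f' \<cdot> g') \<cdot> h)"
    if V: "compact_obj C V" and k: "k \<in> Hom C Z (dual K V)" and h: "h \<in> Hom C V Z'" and kh: "matches T V k h"
    for V k h
  proof -
    have "matches S V (k \<cdot> g) (g' \<cdot> h)"
      using g' V k h kh g by (auto simp: extends_def in_Hom_iff)
    then have "matches R V ((k \<cdot> g) \<cdot> f) (f' \<cdot> g' \<cdot> h)"
      using f' f V comp_hom[OF g k] comp_hom[OF h fg(2)] by (simp add: extends_def in_Hom_iff[of f] del: assoc_comp)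
    then show ?thesis
      using comp_assoc[OF f g k] comp_assoc[OF h fg(2,1)] by simp
  qed
  moreover have "Cod C (g \<cdot> f) = Z" using f g by (simp add: in_Hom_iff)
  ultimately show ?thesis
    using comp_hom[OF fg(2,1)] by (simp add: extends_def)
qed

text \<open>When the projections are the duals of the injections, matching arrows are exactly those
  exchanged by \<open>flip\<close>, and naturality of \<open>flip\<close> along \<open>f\<close>
  gives the claim.\<close>

lemma extends_compact:
  assumes S: "dual_presentation U C M K X (dual K X) S" and T: "dual_presentation U C M K Y (dual K Y) T"
    and X: "compact_obj C X" "Proj S = (\<lambda>i. dual_arr C K (Inj S i))"
    and Y: "compact_obj C Y" "Proj T = (\<lambda>i. dual_arr C K (Inj T i))"
    and f: "f \<in> Hom C X Y"
  shows "extends S T (dual K X) (dual K Y) f (dual_arr C K f)"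
proof -
  note S' = dual_presentationD[OF S] and T' = dual_presentationD[OF T]
  have flip_matches: "matches R Z k (flip W Z k)"
    if "dual_presentation U C M K W (dual K W) R" "compact_obj C W" "Proj R = (\<lambda>i. dual_arr C K (Inj R i))"
      "compact_obj C Z" "k \<in> Hom C W (dual K Z)" for R W Z k
    using that flip_comp[OF dual_presentationD(5)[OF that(1)] that(2,4) dual_presentationD(7)[OF that(1)]]
    by (simp add: matches_def)
  have "matches S Z (k \<cdot> f) (dual_arr C K f \<cdot> h)"
    if Z: "compact_obj C Z" and k: "k \<in> Hom C Y (dual K Z)" and h: "h \<in> Hom C Z (dual K Y)" and kh: "matches T Z k h"
    for Z k h
  proof -
    \<comment> \<open>Both arrows match \<open>k\<close>, so they have equal composites with all
      projections of \<open>T\<close>.\<close>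
    have "h = flip Y Z k"
      using flip_matches[OF T Y Z k] kh
      by (intro limit_eqI[OF T h flip(1)[OF Y(1) Z k]]) (simp add: matches_def)
    then show ?thesis
      using flip_matches[OF S X Z comp_hom[OF f k]] flip_comp[OF X(1) Y(1) Z f k] by simp
  qed
  then show ?thesis
    using dual_arr(1)[OF X(1) Y(1) f] f by (simp add: extends_def in_Hom_iff[of f])
qed

end

section \<open>Assembling the functor from chosen presentations\<close>

theorem theorem5p10:
  fixes C :: "('o, 'm) smcat"
    and U :: "'u set"
    and E M :: "'m set"
    and K :: "('o, 'm) duals"
  assumes "compactly_accessible U C E M"
    and "choice_of_duals C K"
  shows "\<exists>(F :: ('o, 'm, 'o, 'm) cfunctor) (S :: 'o \<Rightarrow> ('u, 'o, 'm) presentation).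
    is_functor (op_cat C) C F \<and>
    (\<forall>X\<in>Obj C. dual_presentation U C M K X (FObj F X) (S X)) \<and>
    (\<forall>X Y. \<forall>f\<in>Hom C X Y.
       constructed_dual_arr C E M K (S X) (S Y) (FObj F X) (FObj F Y) f (FArr F f)) \<and>
    (\<forall>X. compact_obj C X \<longrightarrow> FObj F X = dual K X) \<and>
    (\<forall>X Y. compact_obj C X \<longrightarrow> compact_obj C Y \<longrightarrow>
       (\<forall>f\<in>Hom C X Y. FArr F f = dual_arr C K f))"
proof -
  interpret symmetric_monoidal_category C
    using assms(1) by (simp add: compactly_accessible_def)
  interpret compactly_accessible_duals C K U E M
    by unfold_locales (fact assms)+
  \<comment> \<open>One presentation per object is fixed once and for all, with the special form
    required at compact objects built into the choice.\<close>
  have "\<forall>X. \<exists>X' S. X \<in> Obj C \<longrightarrow> dual_presentation U C M K X X' S \<and>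
      (compact_obj C X \<longrightarrow> X' = dual K X \<and> Proj S = (\<lambda>i. dual_arr C K (Inj S i)))"
    using dual_presentation_exists by metis
  then obtain D S where S: "\<And>X. X \<in> Obj C \<Longrightarrow> dual_presentation U C M K X (D X) (S X)"
    and S_compact: "\<And>X. compact_obj C X \<Longrightarrow> D X = dual K X \<and> Proj (S X) = (\<lambda>i. dual_arr C K (Inj (S X) i))"
    by (metis compact_arr(1))
  define ext where "ext f = extends (S (Dom C f)) (S (Cod C f)) (D (Dom C f)) (D (Cod C f)) f" for f
  \<comment> \<open>The value on an arrow is picked by \<open>SOME\<close>; existence makes the pick
    an extension of \<open>f\<close>, and uniqueness (\<open>F_eq\<close>) identifies it with any
    other. Each functor law thus amounts to exhibiting an extension.\<close>
  define F where "F = \<lparr>FObj = D, FArr = \<lambda>f. SOME g. ext f g\<rparr>"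
  have ext_F: "ext f (FArr F f)" if "f \<in> Arr C" for f
    using extends_exists[OF S S] that unfolding F_def ext_def by (auto simp: in_Hom_iff intro: someI_ex)
  have F_eq: "FArr F f = g" if "f \<in> Arr C" "ext f g" for f g
    using extends_unique[OF S S _ ext_F[unfolded ext_def]] that unfolding ext_def
    by (auto simp: in_Hom_iff)
  have F_hom: "FArr F f \<in> Hom C (D Y) (D X)" if "f \<in> Hom C X Y" for X Y f
    using ext_F[of f] that by (auto simp: ext_def extends_def in_Hom_iff)
  have "is_functor (op_cat C) C F"
    unfolding is_functor_def
  proof (intro conjI ballI allI)
    show "category (op_cat C)" "category C" by (rule category_op) (rule category_axioms)
    show "FObj F X \<in> Obj C" if "X \<in> Obj (op_cat C)" for X
      using dual_presentationD(2)[OF S] that by (simp add: F_def)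
    show "FArr F f \<in> Hom C (FObj F X) (FObj F Y)" if "f \<in> Hom (op_cat C) X Y" for X Y f
      using F_hom that by (simp add: Hom_op_cat F_def)
    show "FArr F (Ident (op_cat C) X) = Ident C (FObj F X)" if "X \<in> Obj (op_cat C)" for X
      using F_eq[of "Ident C X" "Ident C (D X)"] extends_ident[OF S] that
      by (simp add: ext_def F_def op_cat_def)
    show "FArr F (g \<cdot>\<^bsub>op_cat C\<^esub> f) = FArr F g \<cdot>\<^bsub>C\<^esub> FArr F f"
      if "f \<in> Hom (op_cat C) X Y" "g \<in> Hom (op_cat C) Y Z" for X Y Z f g
    proof -
      have f: "f \<in> Hom C Y X" and g: "g \<in> Hom C Z Y" using that by (simp_all add: Hom_op_cat)
      \<comment> \<open>The roles of \<open>f\<close> and \<open>g\<close> are exchanged here, since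
        composition in \<open>op_cat C\<close> is reversed.\<close>
      have "extends (S Z) (S X) (D Z) (D X) (f \<cdot>\<^bsub>C\<^esub> g) (FArr F g \<cdot>\<^bsub>C\<^esub> FArr F f)"
        using ext_F[of f] ext_F[of g] f g
        by (intro extends_comp[OF g f]) (auto simp: ext_def in_Hom_iff)
      then show ?thesis
        using f g by (simp add: Comp_op_cat, intro F_eq) (auto simp: ext_def in_Hom_iff)
    qed
  qed
  moreover have "constructed_dual_arr C E M K (S X) (S Y) (FObj F X) (FObj F Y) f (FArr F f)"
    if f: "f \<in> Hom C X Y" for X Y f
    using extends_constructed[OF S S f] ext_F[of f] f by (auto simp: ext_def in_Hom_iff F_def)
  moreover have "FArr F f = dual_arr C K f"
    if c: "compact_obj C X" "compact_obj C Y" and f: "f \<in> Hom C X Y" for X Y f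
    using extends_compact[of X "S X" Y "S Y" f] S[of X] S[of Y] S_compact[of X] S_compact[of Y] c f
    by (intro F_eq) (auto simp: ext_def in_Hom_iff)
  ultimately show ?thesis
    using S S_compact by (intro exI[of _ F] exI[of _ S]) (auto simp: F_def)
qed

end
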